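(* Let $\sigma$ be a type and $\mathcal O$ an antichain of core $\sigma$-structures. Then there exists a finite family $\mathcal D$ of $\sigma$-structures such that $(\mathcal O,\mathcal D)$ is a duality pair if and only if $\mathcal O$ is a regular family of $\sigma$-forests.
   Context: A type $\sigma$ is a finite set of relation symbols with arities; a $\sigma$-structure $\mathbf A$ is a finite set $V(\mathbf A)$ with an $r$-ary relation $R(\mathbf A)$ for each $R\in\sigma$ of arity $r$. Homomorphisms are maps preserving all relations; $\mathbf A\to\mathbf B$ means one exists. The core of $\mathbf A$ is a structure homomorphically equivalent to $\mathbf A$ with the minimum number of vertices (unique up to isomorphism); $\mathbf A$ is a core if it is its own core. A family is an antichain if there is no homomorphism between any two distinct members. A pair $(\mathcal O,\mathcal D)$ of families of $\sigma$-structures is a duality pair if for every $\sigma$-structure $\mathbf A$: $\mathbf A\to\mathbf D$ for some $\mathbf D\in\mathcal D$ iff there is no $\mathbf T\in\mathcal O$ with $\mathbf T\to\mathbf A$. The incidence multigraph $\mathrm{Inc}(\mathbf A)$ is bipartite with parts $V(\mathbf A)$ and the blocks $(R,(x_1,\dots,x_r))$, $(x_1,\dots,x_r)\in R(\mathbf A)$, with an edge joining $x_i$ to the block for each $i$. $\mathbf A$ is a $\sigma$-forest if $\mathrm{Inc}(\mathbf A)$ has no cycles or parallel edges. Let $\mathbb F$ be the set of isomorphism classes of $\sigma$-forests and $\mathbb F_{\mathrm r}$ that of rooted $\sigma$-forests $(\mathbf A,a)$, $a\in V(\mathbf A)$. $(\mathbf A,a)+(\mathbf B,b)$ is the disjoint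 union with $a,b$ identified (new root), $[(\mathbf A,a)]$ forgets the root. For $\mathcal O\subseteq\mathbb F$, $\mathcal O-(\mathbf A,a)=\{(\mathbf B,b)\in\mathbb F_{\mathrm r}:[(\mathbf A,a)+(\mathbf B,b)]\in\mathcal O\}$, and $\mathcal O$ is regular if there are only finitely many distinct sets $\mathcal O-(\mathbf A,a)$, $(\mathbf A,a)\in\mathbb F_{\mathrm r}$. *)

theory Defs
  imports Main
begin

text \<open>A type (signature) sigma is a finite set sig of relation symbols of type 'r
  together with an arity function ar.  A sigma-structure has a finite vertex set
  of natural numbers (every finite structure is isomorphic to such a one) and an
  interpretation of each relation symbol as a set of tuples (lists).\<close>

record 'r struc =
  verts :: "nat set"
  rels :: "'r \<Rightarrow> nat list set"

definition is_struc :: "'r set \<Rightarrow> ('r \<Rightarrow> nat) \<Rightarrow> 'r struc \<Rightarrow> bool" where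
  "is_struc sig ar A \<longleftrightarrow> finite (verts A) \<and> (\<forall>R. R \<notin> sig \<longrightarrow> rels A R = {}) \<and>
     (\<forall>R\<in>sig. \<forall>xs\<in>rels A R. length xs = ar R \<and> set xs \<subseteq> verts A)"

definition is_hom :: "'r set \<Rightarrow> 'r struc \<Rightarrow> 'r struc \<Rightarrow> (nat \<Rightarrow> nat) \<Rightarrow> bool" where
  "is_hom sig A B f \<longleftrightarrow> f ` verts A \<subseteq> verts B \<and>
     (\<forall>R\<in>sig. \<forall>xs\<in>rels A R. map f xs \<in> rels B R)"

definition hom_to :: "'r set \<Rightarrow> 'r struc \<Rightarrow> 'r struc \<Rightarrow> bool" where
  "hom_to sig A B \<longleftrightarrow> (\<exists>f. is_hom sig A B f)"

definition hom_equiv :: "'r set \<Rightarrow> 'r struc \<Rightarrow> 'r struc \<Rightarrow> bool" where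
  "hom_equiv sig A B \<longleftrightarrow> hom_to sig A B \<and> hom_to sig B A"

definition is_iso :: "'r set \<Rightarrow> 'r struc \<Rightarrow> 'r struc \<Rightarrow> bool" where
  "is_iso sig A B \<longleftrightarrow> (\<exists>f. bij_betw f (verts A) (verts B) \<and>
     (\<forall>R\<in>sig. rels B R = map f ` rels A R))"

definition is_core :: "'r set \<Rightarrow> ('r \<Rightarrow> nat) \<Rightarrow> 'r struc \<Rightarrow> bool" where
  "is_core sig ar A \<longleftrightarrow> is_struc sig ar A \<and>
     \<not> (\<exists>B. is_struc sig ar B \<and> hom_equiv sig A B \<and> card (verts B) < card (verts A))"

definition antichain :: "'r set \<Rightarrow> 'r struc set \<Rightarrow> bool" where
  "antichain sig F \<longleftrightarrow> (\<forall>A\<in>F. \<forall>B\<in>F. A \<noteq> B \<longrightarrow> \<not> hom_to sig A B)"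

definition duality_pair :: "'r set \<Rightarrow> ('r \<Rightarrow> nat) \<Rightarrow> 'r struc set \<Rightarrow> 'r struc set \<Rightarrow> bool" where
  "duality_pair sig ar Ob D \<longleftrightarrow> (\<forall>A. is_struc sig ar A \<longrightarrow>
     ((\<exists>D0\<in>D. hom_to sig A D0) \<longleftrightarrow> \<not> (\<exists>T\<in>Ob. hom_to sig T A)))"

text \<open>Incidence multigraph: vertex nodes Inl x, block nodes Inr (R, xs); the block
  (R,xs) is joined to xs!i for every i.  Since edges only join vertices to blocks,
  parallel edges occur exactly when some tuple has a repeated entry; otherwise the
  multigraph is the simple bipartite graph with adjacency inc_adj.\<close>

definition inc_nodes :: "'r set \<Rightarrow> 'r struc \<Rightarrow> (nat + ('r \<times> nat list)) set" where
  "inc_nodes sig A = Inl ` verts A \<union> Inr ` {(R, xs). R \<in> sig \<and> xs \<in> rels A R}"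

definition inc_adj :: "'r set \<Rightarrow> 'r struc \<Rightarrow> (nat + ('r \<times> nat list)) \<Rightarrow> (nat + ('r \<times> nat list)) \<Rightarrow> bool" where
  "inc_adj sig A u v \<longleftrightarrow>
     (\<exists>x R xs. R \<in> sig \<and> xs \<in> rels A R \<and> x \<in> set xs \<and>
        ((u = Inl x \<and> v = Inr (R, xs)) \<or> (u = Inr (R, xs) \<and> v = Inl x)))"

definition has_cycle :: "'a set \<Rightarrow> ('a \<Rightarrow> 'a \<Rightarrow> bool) \<Rightarrow> bool" where
  "has_cycle N E \<longleftrightarrow> (\<exists>vs. length vs \<ge> 3 \<and> distinct vs \<and> set vs \<subseteq> N \<and>
     (\<forall>i. Suc i < length vs \<longrightarrow> E (vs ! i) (vs ! Suc i)) \<and> E (last vs) (hd vs))"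

definition is_forest :: "'r set \<Rightarrow> ('r \<Rightarrow> nat) \<Rightarrow> 'r struc \<Rightarrow> bool" where
  "is_forest sig ar A \<longleftrightarrow> is_struc sig ar A \<and>
     (\<forall>R\<in>sig. \<forall>xs\<in>rels A R. distinct xs) \<and>
     \<not> has_cycle (inc_nodes sig A) (inc_adj sig A)"

definition is_rooted_forest :: "'r set \<Rightarrow> ('r \<Rightarrow> nat) \<Rightarrow> 'r struc \<times> nat \<Rightarrow> bool" where
  "is_rooted_forest sig ar Aa \<longleftrightarrow> is_forest sig ar (fst Aa) \<and> snd Aa \<in> verts (fst Aa)"

text \<open>C is (a copy of) the structure [(A,a)+(B,b)]: the disjoint union of A and B
  with a and b identified.\<close>
definition is_glue :: "'r set \<Rightarrow> 'r struc \<Rightarrow> 'r struc \<times> nat \<Rightarrow> 'r struc \<times> nat \<Rightarrow> bool" where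
  "is_glue sig C Aa Bb \<longleftrightarrow> (case Aa of (A, a) \<Rightarrow> case Bb of (B, b) \<Rightarrow>
     (\<exists>f g. inj_on f (verts A) \<and> inj_on g (verts B) \<and> f a = g b \<and>
        f ` verts A \<union> g ` verts B = verts C \<and>
        f ` verts A \<inter> g ` verts B = {f a} \<and>
        (\<forall>R\<in>sig. rels C R = map f ` rels A R \<union> map g ` rels B R) \<and>
        (\<forall>R. R \<notin> sig \<longrightarrow> rels C R = {})))"

definition in_fam :: "'r set \<Rightarrow> 'r struc \<Rightarrow> 'r struc set \<Rightarrow> bool" where
  "in_fam sig C F \<longleftrightarrow> (\<exists>T\<in>F. is_iso sig C T)"

definition quot_fam :: "'r set \<Rightarrow> ('r \<Rightarrow> nat) \<Rightarrow> 'r struc set \<Rightarrow> 'r struc \<times> nat \<Rightarrow> ('r struc \<times> nat) set" where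
  "quot_fam sig ar F Aa = {Bb. is_rooted_forest sig ar Bb \<and>
     (\<exists>C. is_glue sig C Aa Bb \<and> in_fam sig C F)}"

definition regular :: "'r set \<Rightarrow> ('r \<Rightarrow> nat) \<Rightarrow> 'r struc set \<Rightarrow> bool" where
  "regular sig ar F \<longleftrightarrow> finite (quot_fam sig ar F ` {Aa. is_rooted_forest sig ar Aa})"

end

theory Submission
  imports Defs "HOL-Library.FuncSet" "HOL-Library.Nat_Bijection"
begin

text \<open>If a finite dual \<open>\<D>\<close> exists, then every structure over a member \<open>C\<close> of the family that maps to no
  dual admits a section over \<open>C\<close>, since \<open>C\<close> is a core of an antichain. Applied to a twisted stack of copies of \<open>C\<close>
  this excludes cycles. Applied to structures over \<open>A + B\<close> it shows that \<open>\<O> - (A, a)\<close> depends only on the values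
  at \<open>a\<close> of homomorphisms to the duals, on the tuples at \<open>a\<close> alone, and on the ways in which
  structures over \<open>A\<close> without a section through part of their fibre over \<open>a\<close> fail to extend colourings of that fibre.

  Conversely, for a regular family of forests colour each vertex \<open>x\<close> of \<open>A\<close> by the set of classes
  \<open>\<O> - (T, t)\<close> of the rooted forests mapping to \<open>(A, x)\<close>. The images of the structures \<open>A\<close> under these colourings, for
  all \<open>A\<close> admitting no member of the family, are finitely many. A homomorphism from a member of the family to such an image
  lifts to \<open>A\<close> up to a mismatch at some incidences, and replacing branches by equivalent ones removes the mismatches.\<close>

section \<open>Homomorphisms and cores\<close>

text \<open>Regularity is a finite-index condition in the manner of Myhill and Nerode, so the
  forward direction needs an invariant of \<open>(A, a)\<close> with finitely many values that
  decides membership for every gluing. Homomorphisms to the duals show only that the exchanged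
  gluing \<open>A' + B\<close> admits some member \<open>T\<close> of the family; that
  \<open>A' + B\<close> is itself a member amounts to a section of \<open>T\<close> over it. If
  there is none, each vertex of \<open>T\<close> over the root fails to lift \<open>A'\<close> or
  fails to lift \<open>B\<close>, since two sections through one vertex could be combined. This
  splits the fibre in two, and the recorded obstructions are the trace that the half of
  \<open>T\<close> over \<open>A'\<close> leaves on the split, measured by sets of colours in the
  duals so that only finitely many traces exist. In the converse direction the difficulty is that a
  homomorphism to a colour image lifts each tuple separately, so that blocks sharing a vertex may
  disagree about its value.\<close>

lemma is_homI:
  assumes "\<And>x. x \<in> verts A \<Longrightarrow> f x \<in> verts B"
    and "\<And>R xs. R \<in> sig \<Longrightarrow> xs \<in> rels A R \<Longrightarrow> map f xs \<in> rels B R"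
  shows "is_hom sig A B f"
  using assms unfolding is_hom_def by blast

lemma is_homD:
  assumes "is_hom sig A B f"
  shows "x \<in> verts A \<Longrightarrow> f x \<in> verts B"
    and "R \<in> sig \<Longrightarrow> xs \<in> rels A R \<Longrightarrow> map f xs \<in> rels B R"
  using assms unfolding is_hom_def by blast+

lemma is_strucD:
  assumes "is_struc sig ar A"
  shows "finite (verts A)"
    and "xs \<in> rels A R \<Longrightarrow> R \<in> sig"
    and "xs \<in> rels A R \<Longrightarrow> length xs = ar R"
    and "xs \<in> rels A R \<Longrightarrow> x \<in> set xs \<Longrightarrow> x \<in> verts A"
  using assms unfolding is_struc_def by blast+

lemma is_strucI:
  assumes "finite (verts A)"
    and "\<And>R xs. xs \<in> rels A R \<Longrightarrow> R \<in> sig \<and> length xs = ar R \<and> set xs \<subseteq> verts A"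
  shows "is_struc sig ar A"
  using assms unfolding is_struc_def by blast

lemma is_hom_comp:
  assumes "is_hom sig A B f" "is_hom sig B C g"
  shows "is_hom sig A C (g \<circ> f)"
  using is_homD[OF assms(1)] is_homD[OF assms(2)] by (intro is_homI) (simp_all flip: map_map)

lemma is_hom_cong:
  assumes "is_struc sig ar A" "\<And>x. x \<in> verts A \<Longrightarrow> f x = g x" "is_hom sig A B f"
  shows "is_hom sig A B g"
proof (rule is_homI)
  show "g x \<in> verts B" if "x \<in> verts A" for x
    using that assms(2)[OF that] is_homD(1)[OF assms(3) that] by simp
  fix R xs assume a: "R \<in> sig" "xs \<in> rels A R"
  have "map g xs = map f xs"
    using is_strucD(4)[OF assms(1) a(2)] assms(2) by simp
  then show "map g xs \<in> rels B R" using is_homD(2)[OF assms(3) a] by (simp only:)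
qed

lemma hom_to_trans: "hom_to sig A B \<Longrightarrow> hom_to sig B C \<Longrightarrow> hom_to sig A C"
  unfolding hom_to_def using is_hom_comp by blast

definition image_struc :: "(nat \<Rightarrow> nat) \<Rightarrow> 'r struc \<Rightarrow> 'r struc" where
  "image_struc f A = \<lparr>verts = f ` verts A, rels = (\<lambda>R. map f ` rels A R)\<rparr>"

lemma verts_image_struc [simp]: "verts (image_struc f A) = f ` verts A"
  and rels_image_struc [simp]: "rels (image_struc f A) R = map f ` rels A R"
  by (simp_all add: image_struc_def)

lemma is_struc_image:
  assumes "is_struc sig ar A" shows "is_struc sig ar (image_struc f A)"
  using is_strucD[OF assms] by (intro is_strucI) auto

lemma is_hom_image: "is_hom sig A (image_struc f A) f"
  by (rule is_homI) auto

text \<open>Otherwise the image of \<open>T\<close> under \<open>e\<close>, which includes back into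
  \<open>T\<close>, would be an equivalent structure with fewer vertices.\<close>

lemma core_endo_inj:
  assumes "is_core sig ar T" "is_hom sig T T e"
  shows "inj_on e (verts T)"
proof (rule ccontr)
  assume "\<not> inj_on e (verts T)"
  have st: "is_struc sig ar T" using assms(1) by (simp add: is_core_def)
  have "card (e ` verts T) < card (verts T)"
    using \<open>\<not> inj_on e (verts T)\<close> card_image_le[OF is_strucD(1)[OF st], of e]
      eq_card_imp_inj_on[OF is_strucD(1)[OF st], of e] by linarith
  moreover have "is_hom sig (image_struc e T) T id"
    using is_homD[OF assms(2)] by (intro is_homI) auto
  ultimately show False
    using assms(1) is_struc_image[OF st, of e] is_hom_image[of sig T e]
    unfolding is_core_def hom_equiv_def hom_to_def by (metis verts_image_struc)
qed

lemma is_hom_funpow: "is_hom sig T T e \<Longrightarrow> is_hom sig T T (e ^^ n)"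
proof (induction n)
  case 0 show ?case by (rule is_homI) auto
next
  case (Suc n) then show ?case using is_hom_comp[of sig T T "e ^^ n" T e] by (simp add: o_def)
qed

lemma core_endo_inverse:
  assumes "is_core sig ar T" "is_hom sig T T e"
  obtains k where "is_hom sig T T k" "\<And>v. v \<in> verts T \<Longrightarrow> e (k v) = v"
proof -
  have fin: "finite (verts T)" using assms(1) is_strucD(1) unfolding is_core_def by blast
  define F where "F n = restrict (e ^^ n) (verts T)" for n
  have "range F \<subseteq> verts T \<rightarrow>\<^sub>E verts T"
    using is_homD(1)[OF is_hom_funpow[OF assms(2)]] by (auto simp: F_def)
  then have "finite (range F)"
    by (rule finite_subset) (intro finite_PiE fin)
  then have "\<not> inj F" using finite_imageD by blast
  then obtain i j where ij: "i < j" "F i = F j"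
    by (metis injI linorder_neqE_nat)
  \<comment> \<open>Cancelling the injective power \<open>e ^^ i\<close> makes
    \<open>e ^^ (j - i)\<close> the identity on \<open>T\<close>. One factor \<open>e\<close> is
    split off, and the remaining power is the inverse \<open>k\<close>.\<close>
  define m where "m = j - i - 1"
  have j: "j = i + Suc m" using ij by (simp add: m_def)
  have "(e ^^ Suc m) v = v" if v: "v \<in> verts T" for v
  proof -
    have "(e ^^ i) ((e ^^ Suc m) v) = (e ^^ j) v"
      unfolding j funpow_add by simp
    also have "\<dots> = (e ^^ i) v"
      using fun_cong[OF ij(2), of v] v by (simp add: F_def)
    finally have "(e ^^ i) ((e ^^ Suc m) v) = (e ^^ i) v" .
    moreover have "(e ^^ Suc m) v \<in> verts T"
      using is_homD(1)[OF is_hom_funpow[OF assms(2)] v] .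
    ultimately show ?thesis
      using inj_onD[OF core_endo_inj[OF assms(1) is_hom_funpow[OF assms(2), of i]], of "(e ^^ Suc m) v" v]
        v by fast
  qed
  then show ?thesis using that[OF is_hom_funpow[OF assms(2), of m]] by (simp only: funpow.simps o_apply)
qed

definition is_section :: "'r set \<Rightarrow> 'r struc \<Rightarrow> 'r struc \<Rightarrow> (nat \<Rightarrow> nat) \<Rightarrow> (nat \<Rightarrow> nat) \<Rightarrow> bool" where
  "is_section sig C S f g \<longleftrightarrow> is_hom sig C S g \<and> (\<forall>v\<in>verts C. f (g v) = v)"

text \<open>As \<open>S\<close> maps to no dual, some member maps to \<open>S\<close> and on to
  \<open>C\<close>. By the antichain property it is the member isomorphic to \<open>C\<close>, so
  the round trip is an endomorphism of a core, and correcting by its inverse gives a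
  section.\<close>

lemma in_fam_section:
  assumes dual: "duality_pair sig ar Ob D" and cores: "\<forall>T\<in>Ob. is_core sig ar T"
    and anti: "antichain sig Ob"
    and C: "is_struc sig ar C" "in_fam sig C Ob"
    and S: "is_struc sig ar S" "is_hom sig S C f" "\<And>D0. D0 \<in> D \<Longrightarrow> \<not> hom_to sig S D0"
  obtains g where "is_section sig C S f g"
proof -
  obtain T i where T: "T \<in> Ob" and i: "bij_betw i (verts C) (verts T)"
    and ir: "\<forall>R\<in>sig. rels T R = map i ` rels C R"
    using C(2) unfolding in_fam_def is_iso_def by blast
  have ih: "is_hom sig C T i" using bij_betwE[OF i] ir by (intro is_homI) auto
  have "\<exists>T'\<in>Ob. hom_to sig T' S"
    using dual S(1,3) unfolding duality_pair_def by blast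
  then obtain T' u where T': "T' \<in> Ob" "is_hom sig T' S u"
    unfolding hom_to_def by blast
  have eT: "is_hom sig T' T (i \<circ> (f \<circ> u))"
    by (rule is_hom_comp[OF is_hom_comp[OF T'(2) S(2)] ih])
  then have "hom_to sig T' T" unfolding hom_to_def by blast
  then have "T' = T" using anti T T'(1) unfolding antichain_def by metis
  then have u: "is_hom sig T S u" and e: "is_hom sig T T (i \<circ> (f \<circ> u))"
    using T'(2) eT by blast+
  obtain k where k: "is_hom sig T T k" "\<And>v. v \<in> verts T \<Longrightarrow> (i \<circ> (f \<circ> u)) (k v) = v"
    using core_endo_inverse[OF bspec[OF cores T] e] by metis
  have "is_hom sig C S (u \<circ> (k \<circ> i))" by (rule is_hom_comp[OF is_hom_comp[OF ih k(1)] u])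
  moreover have "f ((u \<circ> (k \<circ> i)) v) = v" if v: "v \<in> verts C" for v
  proof -
    have "i (f (u (k (i v)))) = i v" using k(2)[OF is_homD(1)[OF ih v]] by simp
    moreover have "f (u (k (i v))) \<in> verts C"
      by (intro is_homD(1)[OF S(2)] is_homD(1)[OF u] is_homD(1)[OF k(1)] is_homD(1)[OF ih v])
    ultimately show ?thesis using inj_onD[OF bij_betw_imp_inj_on[OF i], of "f (u (k (i v)))" v] v by simp
  qed
  ultimately show ?thesis using that[of "u \<circ> (k \<circ> i)"] by (simp add: is_section_def)
qed

text \<open>The composite of \<open>f\<close> and \<open>g\<close> is an idempotent endomorphism of
  the core \<open>T\<close>. It is injective, hence the identity on \<open>T\<close>, so
  \<open>f\<close> and \<open>g\<close> are mutually inverse isomorphisms.\<close>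

lemma section_in_fam:
  assumes core: "is_core sig ar T" and T: "T \<in> Ob"
    and f: "is_hom sig T C f" and sec: "is_section sig C T f g"
  shows "in_fam sig C Ob"
proof -
  have g: "is_hom sig C T g" and fg: "\<And>v. v \<in> verts C \<Longrightarrow> f (g v) = v"
    using sec by (auto simp: is_section_def)
  have st: "is_struc sig ar T" using core by (simp add: is_core_def)
  have gf: "g (f t) = t" if "t \<in> verts T" for t
  proof -
    have "g (f (g (f t))) = g (f t)" using fg is_homD(1)[OF f that] by simp
    then show ?thesis
      using inj_onD[OF core_endo_inj[OF core is_hom_comp[OF f g]], of "g (f t)" t]
        that is_homD(1)[OF f that] is_homD(1)[OF g] by simp
  qed
  have "bij_betw g (verts C) (verts T)"
    using fg gf is_homD(1)[OF f] is_homD(1)[OF g] by (intro bij_betw_byWitness[where f' = f]) auto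
  moreover have "rels T R = map g ` rels C R" if R: "R \<in> sig" for R
  proof
    show "map g ` rels C R \<subseteq> rels T R" using is_homD(2)[OF g R] by blast
    show "rels T R \<subseteq> map g ` rels C R"
    proof
      fix ts assume ts: "ts \<in> rels T R"
      have "map g (map f ts) = ts"
        using gf is_strucD(4)[OF st ts] by (simp add: map_idI)
      then show "ts \<in> map g ` rels C R" using is_homD(2)[OF f R ts] by (metis imageI)
    qed
  qed
  ultimately show ?thesis using T unfolding in_fam_def is_iso_def by blast
qed

section \<open>Acyclicity\<close>

text \<open>Cycles are refuted through potentials: the rest of a cycle is a path between the ends of
  its closing edge, so a function that is constant along all other edges agrees at the two
  ends.\<close>

lemma has_cycle_edge:
  assumes "has_cycle N E"
  obtains u v where "E u v"
    "\<And>P :: 'a \<Rightarrow> nat. (\<And>a b. E a b \<Longrightarrow> {a, b} \<noteq> {u, v} \<Longrightarrow> P a = P b) \<Longrightarrow> P u = P v"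
proof -
  obtain vs where vs: "length vs \<ge> 3" "distinct vs" "E (last vs) (hd vs)"
    "\<And>i. Suc i < length vs \<Longrightarrow> E (vs ! i) (vs ! Suc i)"
    using assms unfolding has_cycle_def by blast
  have lh: "last vs = vs ! (length vs - 1)" "hd vs = vs ! 0"
    using vs(1) last_conv_nth[of vs] hd_conv_nth[of vs] by (cases vs; simp)+
  have "P (last vs) = P (hd vs)"
    if P: "\<And>a b. E a b \<Longrightarrow> {a, b} \<noteq> {last vs, hd vs} \<Longrightarrow> P a = P b" for P :: "'a \<Rightarrow> nat"
  proof -
    have "i < length vs \<Longrightarrow> P (vs ! i) = P (vs ! 0)" for i
    proof (induction i)
      case (Suc i)
      \<comment> \<open>The closing edge does not recur along the path, because the nodes are
        distinct and there are at least three.\<close>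
      have "{vs ! i, vs ! Suc i} \<noteq> {vs ! (length vs - 1), vs ! 0}"
      proof
        assume eq: "{vs ! i, vs ! Suc i} = {vs ! (length vs - 1), vs ! 0}"
        have "vs ! Suc i \<noteq> vs ! 0"
          using nth_eq_iff_index_eq[OF vs(2), of "Suc i" 0] Suc.prems vs(1) by force
        then have "vs ! i = vs ! 0" "vs ! Suc i = vs ! (length vs - 1)"
          using eq by (auto simp: doubleton_eq_iff)
        then have "i = 0" "Suc i = length vs - 1"
          using nth_eq_iff_index_eq[OF vs(2)] Suc.prems
          by (metis Suc_lessD gr_implies_not0 not_gr_zero, metis Suc.prems diff_less gr_implies_not0 not_gr_zero zero_less_one)
        then show False using vs(1) by simp
      qed
      then have "{vs ! i, vs ! Suc i} \<noteq> {last vs, hd vs}" unfolding lh .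
      then have "P (vs ! i) = P (vs ! Suc i)" using P[OF vs(4)[OF Suc.prems]] by blast
      then show ?case using Suc by simp
    qed simp
    then show ?thesis using vs(1) by (simp add: lh)
  qed
  then show ?thesis using that vs(3) by blast
qed

section \<open>Twisted stacks of copies of a structure\<close>

definition lay :: "nat \<Rightarrow> nat \<Rightarrow> nat" where
  "lay k v = prod_encode (v, k)"

definition unlay :: "nat \<Rightarrow> nat" where
  "unlay w = fst (prod_decode w)"

lemma unlay_lay [simp]: "unlay (lay k v) = v"
  by (simp add: lay_def unlay_def)

lemma map_unlay_lay [simp]: "map unlay (map (lay k) ys) = ys"
  by (simp add: o_def)

text \<open>The tuple \<open>xs0\<close> of \<open>R0\<close> never occurs within a layer. All
  ordered pairs of distinct layers carry a twisted version of it, since it is not known in advance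
  which two layers the pigeonhole principle will select.\<close>

definition twist :: "'r struc \<Rightarrow> nat \<Rightarrow> 'r \<Rightarrow> nat list \<Rightarrow> nat \<Rightarrow> 'r struc" where
  "twist T N R0 xs0 i = \<lparr>verts = (\<Union>k<N. lay k ` verts T),
     rels = (\<lambda>R. {map (lay k) ys | ys k. ys \<in> rels T R \<and> (R, ys) \<noteq> (R0, xs0) \<and> k < N} \<union>
       {(map (lay k) xs0)[i := lay l (xs0 ! i)] | k l. R = R0 \<and> k < N \<and> l < N \<and> k \<noteq> l})\<rparr>"

lemma map_unlay_twisted: "map unlay ((map (lay k) xs)[i := lay l (xs ! i)]) = xs"
  by (simp add: map_update o_def)

lemma
  assumes T: "is_struc sig ar T" and e: "R0 \<in> sig" "xs0 \<in> rels T R0" "i < length xs0"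
  shows is_struc_twist: "is_struc sig ar (twist T N R0 xs0 i)"
    and is_hom_unlay: "is_hom sig (twist T N R0 xs0 i) T unlay"
proof -
  show "is_struc sig ar (twist T N R0 xs0 i)"
  proof (rule is_strucI)
    show "finite (verts (twist T N R0 xs0 i))" using is_strucD(1)[OF T] by (auto simp: twist_def)
    fix R xs assume "xs \<in> rels (twist T N R0 xs0 i) R"
    then consider ys k where "xs = map (lay k) ys" "ys \<in> rels T R" "k < N"
      | k l where "xs = (map (lay k) xs0)[i := lay l (xs0 ! i)]" "R = R0" "k < N" "l < N"
      by (auto simp: twist_def)
    then show "R \<in> sig \<and> length xs = ar R \<and> set xs \<subseteq> verts (twist T N R0 xs0 i)"
    proof cases
      case 1
      then show ?thesis using is_strucD(2-4)[OF T 1(2)] by (auto simp: twist_def)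
    next
      case 2
      have "set xs \<subseteq> insert (lay l (xs0 ! i)) (lay k ` set xs0)"
        unfolding 2 using set_update_subset_insert[of "map (lay k) xs0"] by (simp only: set_map)
      then show ?thesis
        using 2 e is_strucD(2-4)[OF T e(2)] nth_mem[OF e(3)] by (fastforce simp: twist_def)
    qed
  qed
  show "is_hom sig (twist T N R0 xs0 i) T unlay"
  proof (rule is_homI)
    show "unlay x \<in> verts T" if "x \<in> verts (twist T N R0 xs0 i)" for x
      using that by (auto simp: twist_def)
    fix R xs assume "xs \<in> rels (twist T N R0 xs0 i) R"
    then consider ys k where "xs = map (lay k) ys" "ys \<in> rels T R"
      | k l where "xs = (map (lay k) xs0)[i := lay l (xs0 ! i)]" "R = R0"
      by (auto simp: twist_def)
    then show "map unlay xs \<in> rels T R"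
      by cases (simp_all only: map_unlay_lay map_unlay_twisted e(2))
  qed
qed

text \<open>With more layers than maps, two layers receive the same map, and the twisted tuple
  joining them supplies the image of \<open>xs0\<close>, the one tuple missing within a
  layer.\<close>

lemma twist_not_hom:
  assumes T: "is_struc sig ar T" and fin: "finite (verts D0)"
    and N: "card (verts T \<rightarrow>\<^sub>E verts D0) < N" and not_hom: "\<not> hom_to sig T D0"
  shows "\<not> hom_to sig (twist T N R0 xs0 i) D0"
proof
  assume "hom_to sig (twist T N R0 xs0 i) D0"
  then obtain h where h: "is_hom sig (twist T N R0 xs0 i) D0 h" unfolding hom_to_def ..
  define F where "F k = restrict (\<lambda>v. h (lay k v)) (verts T)" for k
  have "F ` {..<N} \<subseteq> verts T \<rightarrow>\<^sub>E verts D0"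
    using is_homD(1)[OF h] unfolding F_def twist_def by (simp add: image_subset_iff) blast
  moreover have "finite (verts T \<rightarrow>\<^sub>E verts D0)"
    using is_strucD(1)[OF T] fin by (intro finite_PiE)
  ultimately have "card (F ` {..<N}) \<le> card (verts T \<rightarrow>\<^sub>E verts D0)" by (rule card_mono[rotated])
  then have "card (F ` {..<N}) < card {..<N}" using N by simp
  then have "\<not> inj_on F {..<N}" by (rule pigeonhole)
  then obtain k l where kl: "k < N" "l < N" "k \<noteq> l" "F k = F l" by (auto simp: inj_on_def)
  define g where "g v = h (lay k v)" for v
  have gl: "h (lay l v) = g v" if "v \<in> verts T" for v
    using fun_cong[OF kl(4), of v] that by (simp add: F_def g_def)
  have "is_hom sig T D0 g"
  proof (rule is_homI)
    show "g v \<in> verts D0" if "v \<in> verts T" for v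
      using that kl(1) is_homD(1)[OF h] by (auto simp: g_def twist_def)
    fix R ys assume R: "R \<in> sig" "ys \<in> rels T R"
    show "map g ys \<in> rels D0 R"
    proof (cases "(R, ys) = (R0, xs0)")
      case False
      then have "map (lay k) ys \<in> rels (twist T N R0 xs0 i) R"
        using R kl(1) by (auto simp: twist_def)
      from is_homD(2)[OF h R(1) this] show ?thesis by (simp add: g_def[abs_def] o_def)
    next
      case True
      then have "(map (lay k) xs0)[i := lay l (xs0 ! i)] \<in> rels (twist T N R0 xs0 i) R"
        using kl by (auto simp: twist_def)
      from is_homD(2)[OF h R(1) this]
      have "(map g xs0)[i := h (lay l (xs0 ! i))] \<in> rels D0 R"
        by (simp add: map_update o_def g_def[abs_def])
      moreover have "(map g xs0)[i := h (lay l (xs0 ! i))] = map g xs0"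
      proof (cases "i < length xs0")
        case len: True
        then have "xs0 ! i \<in> verts T" using True R is_strucD(4)[OF T] by auto
        then show ?thesis using len gl by (simp add: list_update_same_conv)
      qed (simp add: list_update_beyond)
      ultimately show ?thesis using True by simp
    qed
  qed
  then show False using not_hom unfolding hom_to_def by blast
qed

text \<open>The potential is the layer of \<open>g v\<close>. A section sends each tuple to a tuple
  lying over it: untwisted ones stay in one layer, while only the twisted versions lie over
  \<open>xs0\<close>.\<close>

lemma twist_section_potential:
  assumes T: "is_struc sig ar T" and e: "R0 \<in> sig" "xs0 \<in> rels T R0" "i < length xs0"
    and sec: "is_section sig T (twist T N R0 xs0 i) unlay g"
  obtains \<phi> :: "nat \<Rightarrow> nat" and k l where "k \<noteq> l" "\<phi> (xs0 ! i) = l"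
    "\<And>j. j < length xs0 \<Longrightarrow> j \<noteq> i \<Longrightarrow> \<phi> (xs0 ! j) = k"
    "\<And>R ys. R \<in> sig \<Longrightarrow> ys \<in> rels T R \<Longrightarrow> (R, ys) \<noteq> (R0, xs0) \<Longrightarrow> \<exists>m. \<forall>y\<in>set ys. \<phi> y = m"
proof -
  have g: "is_hom sig T (twist T N R0 xs0 i) g" and ug: "\<And>v. v \<in> verts T \<Longrightarrow> unlay (g v) = v"
    using sec by (auto simp: is_section_def)
  have idl: "map unlay (map g ys) = ys" if "ys \<in> rels T R" for R ys
    using ug is_strucD(4)[OF T that] by (simp add: map_idI)
  define \<phi> where "\<phi> v = snd (prod_decode (g v))" for v
  have \<phi>: "\<phi> v = m" if "g v = lay m w" for v m w
    using that by (simp add: \<phi>_def lay_def)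
  have "\<exists>m. \<forall>y\<in>set ys. \<phi> y = m" if R: "R \<in> sig" "ys \<in> rels T R" "(R, ys) \<noteq> (R0, xs0)" for R ys
  proof -
    have "map g ys \<in> rels (twist T N R0 xs0 i) R" using is_homD(2)[OF g R(1,2)] .
    then consider zs m where "map g ys = map (lay m) zs"
      | m l where "map g ys = (map (lay m) xs0)[i := lay l (xs0 ! i)]" "R = R0"
      by (auto simp: twist_def)
    then show ?thesis
    proof cases
      case 1
      have "zs = ys" using idl[OF R(2)] unfolding 1 by (simp only: map_unlay_lay)
      then show ?thesis using 1 \<phi> by (metis map_eq_conv)
    next
      case 2
      have "xs0 = ys" using idl[OF R(2)] unfolding 2(1) map_unlay_twisted by simp
      then show ?thesis using 2 R(3) by simp
    qed
  qed
  moreover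
  have "map g xs0 \<in> rels (twist T N R0 xs0 i) R0" using is_homD(2)[OF g e(1,2)] .
  then consider zs m where "map g xs0 = map (lay m) zs" "zs \<noteq> xs0"
    | k l where "map g xs0 = (map (lay k) xs0)[i := lay l (xs0 ! i)]" "k \<noteq> l"
    by (auto simp: twist_def)
  then obtain k l where kl: "map g xs0 = (map (lay k) xs0)[i := lay l (xs0 ! i)]" "k \<noteq> l"
  proof cases
    case 1
    then have "zs = xs0" using idl[OF e(2)] unfolding 1 by (simp only: map_unlay_lay)
    then show ?thesis using 1 by simp
  qed
  have nth: "g (xs0 ! j) = (if j = i then lay l (xs0 ! i) else lay k (xs0 ! j))"
    if "j < length xs0" for j
    using arg_cong[OF kl(1), of "\<lambda>zs. zs ! j"] that by (auto simp: nth_list_update)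
  have "\<phi> (xs0 ! i) = l" using \<phi> nth[OF e(3)] by simp
  moreover have "\<phi> (xs0 ! j) = k" if "j < length xs0" "j \<noteq> i" for j
    using \<phi> nth[OF that(1)] that(2) by simp
  ultimately show ?thesis using that kl(2) by blast
qed

text \<open>If \<open>e\<close> is a block of \<open>T\<close> and \<open>x\<close> one of its vertices, take many copies of \<open>T\<close> and let
  \<open>e\<close> take \<open>x\<close> from a copy different from that of its other vertices. The result maps to \<open>T\<close> but, by the
  pigeonhole principle, to no dual; so it must contain \<open>T\<close>, whence \<open>x\<close> and \<open>e\<close> lie on no cycle.\<close>

lemma duality_imp_forest:
  assumes dual: "duality_pair sig ar Ob D" and cores: "\<forall>T\<in>Ob. is_core sig ar T"
    and anti: "antichain sig Ob" and D: "finite D" "\<forall>D0\<in>D. is_struc sig ar D0"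
    and T: "T \<in> Ob"
  shows "is_forest sig ar T"
proof -
  have st: "is_struc sig ar T" using cores T by (simp add: is_core_def)
  have fam: "in_fam sig T Ob" unfolding in_fam_def is_iso_def
    using T by (intro bexI[of _ T] exI[of _ id]) auto
  \<comment> \<open>The sum bounds the number of maps to each single dual, so one stack is high
    enough for all of them.\<close>
  define N where "N = Suc (\<Sum>D0\<in>D. card (verts T \<rightarrow>\<^sub>E verts D0))"
  have "hom_to sig T T" unfolding hom_to_def by (rule exI[of _ id], rule is_homI) auto
  then have not_hom: "\<not> hom_to sig T D0" if "D0 \<in> D" for D0
    using dual st T that unfolding duality_pair_def by blast
  have N: "card (verts T \<rightarrow>\<^sub>E verts D0) < N" if "D0 \<in> D" for D0
    unfolding N_def less_Suc_eq_le using D(1) that by (intro member_le_sum) auto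
  have twist: "\<not> hom_to sig (twist T N R0 xs0 i) D0" if "D0 \<in> D" for D0 R0 xs0 i
    using twist_not_hom[OF st _ N not_hom] is_strucD(1) D(2) that by blast
  have sec: "\<exists>g. is_section sig T (twist T N R0 xs0 i) unlay g"
    if e: "R0 \<in> sig" "xs0 \<in> rels T R0" "i < length xs0" for R0 xs0 i
    by (rule in_fam_section[OF dual cores anti st fam is_struc_twist[OF st e] is_hom_unlay[OF st e] twist])
      (assumption, rule exI)
  have dist: "distinct xs" if R: "R \<in> sig" "xs \<in> rels T R" for R xs
  proof (rule ccontr)
    assume "\<not> distinct xs"
    then obtain i j where ij: "i < length xs" "j < length xs" "i \<noteq> j" "xs ! i = xs ! j"
      unfolding distinct_conv_nth by blast
    obtain g where "is_section sig T (twist T N R xs i) unlay g" using sec[OF R ij(1)] by blast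
    \<comment> \<open>The repeated vertex would lie in layer \<open>l\<close> as the entry
      \<open>i\<close> and in the different layer \<open>k\<close> as the entry
      \<open>j\<close>.\<close>
    from twist_section_potential[OF st R ij(1) this] show False using ij by metis
  qed
  have "\<not> has_cycle (inc_nodes sig T) (inc_adj sig T)"
  proof
    assume "has_cycle (inc_nodes sig T) (inc_adj sig T)"
    then obtain u v where uv: "inc_adj sig T u v"
      and pot: "\<And>P :: _ \<Rightarrow> nat. (\<And>a b. inc_adj sig T a b \<Longrightarrow> {a, b} \<noteq> {u, v} \<Longrightarrow> P a = P b) \<Longrightarrow> P u = P v"
      by (rule has_cycle_edge) blast
    obtain x R xs where R: "R \<in> sig" "xs \<in> rels T R" and x: "x \<in> set xs"
      and uv': "{u, v} = {Inl x, Inr (R, xs)}"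
      using uv unfolding inc_adj_def by blast
    obtain i where i: "i < length xs" "xs ! i = x" using x by (auto simp: in_set_conv_nth)
    obtain g where "is_section sig T (twist T N R xs i) unlay g" using sec[OF R i(1)] by blast
    from twist_section_potential[OF st R i(1) this]
    obtain \<phi> :: "nat \<Rightarrow> nat" and k l where \<phi>: "k \<noteq> l" "\<phi> x = l"
      "\<And>j. j < length xs \<Longrightarrow> j \<noteq> i \<Longrightarrow> \<phi> (xs ! j) = k"
      "\<And>Q ys. Q \<in> sig \<Longrightarrow> ys \<in> rels T Q \<Longrightarrow> (Q, ys) \<noteq> (R, xs) \<Longrightarrow> \<exists>m. \<forall>y\<in>set ys. \<phi> y = m"
      using i(2) by metis
    have k: "\<phi> y = k" if y: "y \<in> set xs" "y \<noteq> x" for y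
      using y \<phi>(3) i(2) by (metis in_set_conv_nth)
    \<comment> \<open>The potential extends to blocks. The twisted block gets the layer
      \<open>k\<close> of its entries other than \<open>x\<close>, so it changes only across the
      edge to \<open>x\<close>; any other block gets the common layer of its entries. For an empty
      tuple \<open>hd\<close> is arbitrary, but no edge meets that block.\<close>
    define P where "P = case_sum \<phi> (\<lambda>(Q, ys). if (Q, ys) = (R, xs) then k else \<phi> (hd ys))"
    have step: "P (Inl y) = P (Inr (Q, ys))"
      if Q: "Q \<in> sig" "ys \<in> rels T Q" "y \<in> set ys" "{Inl y, Inr (Q, ys)} \<noteq> {u, v}" for y Q ys
    proof (cases "(Q, ys) = (R, xs)")
      case True
      then have "y \<noteq> x" using Q(4) uv' by auto
      then show ?thesis using True k Q(3) by (simp add: P_def)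
    next
      case False
      have "hd ys \<in> set ys" using Q(3) by (cases ys) auto
      then have "\<phi> y = \<phi> (hd ys)" using \<phi>(4)[OF Q(1,2) False] Q(3) by metis
      then show ?thesis using False by (auto simp: P_def)
    qed
    have "P u = P v"
    proof (rule pot)
      fix a b assume ab: "inc_adj sig T a b" "{a, b} \<noteq> {u, v}"
      then obtain y Q ys where Q: "Q \<in> sig" "ys \<in> rels T Q" "y \<in> set ys"
        and "{a, b} = {Inl y, Inr (Q, ys)}"
        unfolding inc_adj_def by blast
      then show "P a = P b" using step[OF Q] ab(2) by (auto simp: doubleton_eq_iff)
    qed
    then have "P (Inl x) = P (Inr (R, xs))" using uv' by (metis doubleton_eq_iff)
    then show False using \<phi> by (simp add: P_def)
  qed
  then show ?thesis using st dist unfolding is_forest_def by blast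
qed

section \<open>Obstructions to sections\<close>

definition join :: "'r struc \<Rightarrow> 'r struc \<Rightarrow> 'r struc" where
  "join A B = \<lparr>verts = verts A \<union> verts B, rels = (\<lambda>R. rels A R \<union> rels B R)\<rparr>"

lemma verts_join [simp]: "verts (join A B) = verts A \<union> verts B"
  and rels_join [simp]: "rels (join A B) R = rels A R \<union> rels B R"
  by (simp_all add: join_def)

lemma is_struc_join:
  assumes "is_struc sig ar A" "is_struc sig ar B"
  shows "is_struc sig ar (join A B)"
  using is_strucD[OF assms(1)] is_strucD[OF assms(2)] by (intro is_strucI) auto

lemma is_hom_join:
  assumes A: "is_struc sig ar A" and B: "is_struc sig ar B"
    and h1: "is_hom sig A D h1" and h2: "is_hom sig B D h2"
    and agree: "\<And>v. v \<in> verts A \<Longrightarrow> v \<in> verts B \<Longrightarrow> h1 v = h2 v"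
  shows "is_hom sig (join A B) D (\<lambda>v. if v \<in> verts A then h1 v else h2 v)" (is "is_hom _ _ _ ?h")
proof -
  have 1: "is_hom sig A D ?h" by (rule is_hom_cong[OF A _ h1]) simp
  have 2: "is_hom sig B D ?h" by (rule is_hom_cong[OF B _ h2]) (simp add: agree)
  show ?thesis
  proof (rule is_homI)
    show "?h v \<in> verts D" if "v \<in> verts (join A B)" for v
      using that is_homD(1)[OF 1, of v] is_homD(1)[OF 2, of v] unfolding verts_join by blast
    show "map ?h xs \<in> rels D R" if "R \<in> sig" "xs \<in> rels (join A B) R" for R xs
      using that is_homD(2)[OF 1, of R xs] is_homD(2)[OF 2, of R xs] unfolding rels_join by blast
  qed
qed

lemma in_fam_hom:
  assumes C: "is_struc sig ar C" "in_fam sig C Ob"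
  obtains T where "T \<in> Ob" "hom_to sig T C"
proof -
  obtain T i where T: "T \<in> Ob" and i: "bij_betw i (verts C) (verts T)"
    and ir: "\<forall>R\<in>sig. rels T R = map i ` rels C R"
    using C(2) unfolding in_fam_def is_iso_def by blast
  have inv: "inv_into (verts C) i (i v) = v" if "v \<in> verts C" for v
    using bij_betw_imp_inj_on[OF i] that by simp
  have "is_hom sig T C (inv_into (verts C) i)"
  proof (rule is_homI)
    show "inv_into (verts C) i x \<in> verts C" if "x \<in> verts T" for x
      using that bij_betw_imp_surj_on[OF i] inv_into_into[of x i "verts C"] by simp
    fix R xs assume R: "R \<in> sig" "xs \<in> rels T R"
    then obtain ys where ys: "ys \<in> rels C R" "xs = map i ys" using ir by auto
    have "map (inv_into (verts C) i) xs = ys"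
      unfolding ys(2) using inv is_strucD(4)[OF C(1) ys(1)] by (simp add: map_idI)
    then show "map (inv_into (verts C) i) xs \<in> rels C R" using ys(1) by simp
  qed
  then have "hom_to sig T C" unfolding hom_to_def by blast
  then show ?thesis using that T by blast
qed

lemma in_fam_not_hom:
  assumes "duality_pair sig ar Ob Ds" "is_struc sig ar C" "in_fam sig C Ob" "D \<in> Ds"
  shows "\<not> hom_to sig C D"
  using assms in_fam_hom[OF assms(2,3)] unfolding duality_pair_def by metis

text \<open>When \<open>T\<close> maps to \<open>join A B\<close>, its parts over \<open>A\<close>
  and \<open>B\<close> together cover all vertices and tuples of \<open>T\<close>. If
  \<open>A\<close> and \<open>B\<close> share only the root, the parts share only the vertices over
  the root.\<close>

definition preimage_struc :: "'r struc \<Rightarrow> (nat \<Rightarrow> nat) \<Rightarrow> 'r struc \<Rightarrow> 'r struc" where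
  "preimage_struc T f A =
     \<lparr>verts = {s \<in> verts T. f s \<in> verts A}, rels = (\<lambda>R. {xs \<in> rels T R. map f xs \<in> rels A R})\<rparr>"

lemma verts_preimage [simp]: "verts (preimage_struc T f A) = {s \<in> verts T. f s \<in> verts A}"
  and rels_preimage [simp]: "rels (preimage_struc T f A) R = {xs \<in> rels T R. map f xs \<in> rels A R}"
  by (simp_all add: preimage_struc_def)

lemma is_struc_preimage:
  assumes T: "is_struc sig ar T" and A: "is_struc sig ar A"
  shows "is_struc sig ar (preimage_struc T f A)"
proof (rule is_strucI)
  show "finite (verts (preimage_struc T f A))" using is_strucD(1)[OF T] by simp
  fix R xs assume xs: "xs \<in> rels (preimage_struc T f A) R"
  then have 1: "xs \<in> rels T R" "map f xs \<in> rels A R" by auto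
  have "f x \<in> verts A" if "x \<in> set xs" for x using is_strucD(4)[OF A 1(2)] that by simp
  then show "R \<in> sig \<and> length xs = ar R \<and> set xs \<subseteq> verts (preimage_struc T f A)"
    using is_strucD(2-4)[OF T 1(1)] by auto
qed

lemma is_hom_preimage: "is_hom sig (preimage_struc T f A) A f"
  by (rule is_homI) auto

lemma is_hom_preimage_incl: "is_hom sig (preimage_struc T f A) T id"
  by (rule is_homI) auto

text \<open>\<open>P\<close> refutes \<open>(D, U, W)\<close> if whatever colours in \<open>W\<close> the vertices in \<open>X2\<close> receive, some colouring of
  \<open>X1\<close> by \<open>U\<close> cannot be extended to a homomorphism to \<open>D\<close>. As the colours of \<open>X2\<close> are chosen first,
  \<open>P\<close> not refuting \<open>(D, U, W)\<close> with \<open>(X1, X2)\<close> and \<open>Q\<close> not refuting \<open>(D, W, U)\<close> with \<open>(X2, X1)\<close> together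
  give a homomorphism to \<open>D\<close> from \<open>P\<close> and \<open>Q\<close> glued along \<open>X1 \<union> X2\<close>.\<close>

definition refutes :: "'r set \<Rightarrow> 'r struc \<Rightarrow> nat set \<Rightarrow> nat set \<Rightarrow> 'r struc \<Rightarrow> nat set \<Rightarrow> nat set \<Rightarrow> bool" where
  "refutes sig D U W P X1 X2 \<longleftrightarrow> (\<forall>w. w ` X2 \<subseteq> W \<longrightarrow> (\<exists>c. c ` X1 \<subseteq> U \<and>
     \<not> (\<exists>h. is_hom sig P D h \<and> (\<forall>x\<in>X2. h x = w x) \<and> (\<forall>x\<in>X1. h x = c x))))"

definition refutations :: "'r set \<Rightarrow> 'r struc set \<Rightarrow> 'r struc \<Rightarrow> nat set \<Rightarrow> nat set \<Rightarrow>
    ('r struc \<times> nat set \<times> nat set) set" where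
  "refutations sig Ds P X1 X2 =
     {(D, U, W). D \<in> Ds \<and> U \<subseteq> verts D \<and> W \<subseteq> verts D \<and> refutes sig D U W P X1 X2}"

text \<open>Only \<open>X2\<close> has to consist of vertices through which no section passes. In
  the application \<open>X1\<close> collects the vertices over the root where the other half of the
  gluing fails, so the two halves use the same split with the roles exchanged.\<close>

definition obstruction :: "'r set \<Rightarrow> ('r \<Rightarrow> nat) \<Rightarrow> 'r struc \<Rightarrow> nat \<Rightarrow>
    'r struc \<Rightarrow> (nat \<Rightarrow> nat) \<Rightarrow> nat set \<Rightarrow> nat set \<Rightarrow> bool" where
  "obstruction sig ar A a P f X1 X2 \<longleftrightarrow> is_struc sig ar P \<and> is_hom sig P A f \<and>
     X1 \<union> X2 = {p \<in> verts P. f p = a} \<and> X1 \<inter> X2 = {} \<and>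
     (\<forall>x\<in>X2. \<not> (\<exists>g. is_section sig A P f g \<and> g a = x))"

definition obstruction_types :: "'r set \<Rightarrow> ('r \<Rightarrow> nat) \<Rightarrow> 'r struc set \<Rightarrow> 'r struc \<Rightarrow> nat \<Rightarrow>
    ('r struc \<times> nat set \<times> nat set) set set" where
  "obstruction_types sig ar Ds A a =
     {refutations sig Ds P X1 X2 | P f X1 X2. obstruction sig ar A a P f X1 X2}"

definition root_targets :: "'r set \<Rightarrow> 'r struc set \<Rightarrow> 'r struc \<Rightarrow> nat \<Rightarrow> ('r struc \<times> nat) set" where
  "root_targets sig Ds A a = {(D, h a) | D h. D \<in> Ds \<and> is_hom sig A D h}"

text \<open>Tuples with no entry besides the root are the only ones that the two halves of a gluing
  can share. Those of arity 0 are included, as \<open>replicate 0 a\<close> is the empty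
  tuple.\<close>

definition root_rels :: "'r set \<Rightarrow> ('r \<Rightarrow> nat) \<Rightarrow> 'r struc \<Rightarrow> nat \<Rightarrow> 'r set" where
  "root_rels sig ar A a = {R \<in> sig. replicate (ar R) a \<in> rels A R}"

text \<open>Vertices must be numbers, so kind \<open>t\<close>, copy \<open>k\<close> and original
  vertex \<open>p\<close> are packed into one. In \<open>amalgam\<close> the kinds 0 and 1 are
  private vertices of the copies of \<open>P\<close> and \<open>Q\<close>, and 2 and 3 are the
  shared vertices from \<open>X2\<close> and \<open>Y2\<close>.\<close>

definition tag :: "nat \<Rightarrow> nat \<Rightarrow> nat \<Rightarrow> nat" where
  "tag t k p = prod_encode (t, prod_encode (k, p))"

definition tag_of :: "nat \<Rightarrow> nat" where
  "tag_of v = fst (prod_decode v)"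

definition untag :: "nat \<Rightarrow> nat" where
  "untag v = snd (prod_decode (snd (prod_decode v)))"

lemma untag_tag [simp]: "untag (tag t k p) = p"
  and tag_of_tag [simp]: "tag_of (tag t k p) = t"
  by (simp_all add: tag_def untag_def tag_of_def)

text \<open>The inclusion of copy \<open>k\<close>: all copies share the vertices of
  \<open>X\<close>, those of \<open>X'\<close> are glued by \<open>c k\<close> onto shared vertices
  of the other structure, and the remaining ones stay private.\<close>

definition attach :: "nat \<Rightarrow> nat \<Rightarrow> nat \<Rightarrow> nat set \<Rightarrow> nat set \<Rightarrow> (nat \<Rightarrow> nat \<Rightarrow> nat) \<Rightarrow> nat \<Rightarrow> nat \<Rightarrow> nat" where
  "attach s s' t X X' c k p =
     (if p \<in> X then tag s 0 p else if p \<in> X' then tag s' 0 (c k p) else tag t k p)"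

text \<open>Forgetting the tags merges the copies and loses the vertex only on \<open>X'\<close>.
  There the root would have kind \<open>s'\<close>, whereas \<open>g\<close> gives it kind
  \<open>s\<close>; so the forgetful map turns \<open>g\<close> into a section of \<open>P\<close>
  through \<open>y\<close>.\<close>

lemma section_project:
  assumes A: "is_struc sig ar A"
    and f: "is_hom sig P A f" and X: "X \<union> X' = {p \<in> verts P. f p = r}" "X \<inter> X' = {}"
    and s: "s \<noteq> s'" and r: "r \<in> verts A" "y \<in> X" "g r = tag s 0 y"
    and gv: "\<And>v. v \<in> verts A \<Longrightarrow> v \<noteq> r \<Longrightarrow> \<exists>k. \<exists>p\<in>verts P. f p = v \<and> g v = attach s s' t X X' c k p"
    and gt: "\<And>R xs. R \<in> sig \<Longrightarrow> xs \<in> rels A R \<Longrightarrow>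
      \<exists>k. \<exists>ps\<in>rels P R. map f ps = xs \<and> map g xs = map (attach s s' t X X' c k) ps"
  shows "is_section sig A P f (untag \<circ> g) \<and> (untag \<circ> g) r = y"
proof -
  have vert: "untag (g v) \<in> verts P \<and> f (untag (g v)) = v" if v: "v \<in> verts A" for v
  proof (cases "v = r")
    case True then show ?thesis using r X by auto
  next
    case False
    then obtain k p where p: "p \<in> verts P" "f p = v" "g v = attach s s' t X X' c k p"
      using gv[OF v] by blast
    then have "p \<notin> X \<union> X'" using False X by auto
    then show ?thesis using p by (simp add: attach_def)
  qed
  have "map (untag \<circ> g) xs \<in> rels P R" if R: "R \<in> sig" "xs \<in> rels A R" for R xs
  proof -
    obtain k ps where ps: "ps \<in> rels P R" "map f ps = xs" "map g xs = map (attach s s' t X X' c k) ps"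
      using gt[OF R] by blast
    have gf: "g (f p) = attach s s' t X X' c k p" if "p \<in> set ps" for p
      using ps(2,3) that by (metis (no_types, lifting) comp_apply list.map_comp map_eq_conv)
    have "untag (attach s s' t X X' c k p) = p" if p: "p \<in> set ps" for p
    proof -
      have "p \<notin> X'"
      proof
        assume "p \<in> X'"
        then have "f p = r" "p \<notin> X" using X by auto
        then have "tag s 0 y = tag s' 0 (c k p)"
          using gf[OF p] r(3) \<open>p \<in> X'\<close> by (simp add: attach_def)
        then show False using s by (metis tag_of_tag)
      qed
      then show ?thesis by (simp add: attach_def)
    qed
    then have "map untag (map g xs) = ps" unfolding ps(3) by (simp add: map_idI)
    then show ?thesis using ps(1) by simp
  qed
  then have "is_section sig A P f (untag \<circ> g)"
    unfolding is_section_def using vert by (intro conjI is_homI) auto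
  then show ?thesis using r(3) by simp
qed

lemma finite_enumerate_PiE:
  fixes X Y :: "nat set"
  assumes "finite X" "finite Y"
  shows "\<exists>n. \<exists>c :: nat \<Rightarrow> nat \<Rightarrow> nat. c ` {..<n} = X \<rightarrow>\<^sub>E Y"
proof -
  have "finite (X \<rightarrow>\<^sub>E Y)" using assms by (intro finite_PiE)
  from finite_imp_nat_seg_image_inj_on[OF this] show ?thesis
    unfolding lessThan_def by metis
qed

text \<open>One copy for each function from \<open>X\<close> to \<open>Y\<close> is enough: every
  colouring of \<open>X\<close> by colours present on \<open>Y\<close> is induced by some
  copy.\<close>

lemma lift_through_enumeration:
  fixes c :: "nat \<Rightarrow> nat \<Rightarrow> nat"
  assumes c: "c ` {..<n} = X \<rightarrow>\<^sub>E Y" and w: "w ` X \<subseteq> \<phi> ` Y"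
  obtains k where "k < n" "\<And>x. x \<in> X \<Longrightarrow> \<phi> (c k x) = w x"
proof -
  define d where "d x = (SOME y. y \<in> Y \<and> \<phi> y = w x)" for x
  have "\<exists>y. y \<in> Y \<and> \<phi> y = w x" if "x \<in> X" for x using w that by force
  then have d: "d x \<in> Y \<and> \<phi> (d x) = w x" if "x \<in> X" for x
    unfolding d_def using someI_ex[of "\<lambda>y. y \<in> Y \<and> \<phi> y = w x"] that by blast
  then have "restrict d X \<in> X \<rightarrow>\<^sub>E Y" by auto
  then obtain k where "k < n" "c k = restrict d X" unfolding c[symmetric] by force
  then show ?thesis using that d by simp
qed

text \<open>\<open>P\<close> and \<open>Q\<close> lie over the two halves \<open>A\<close> and \<open>B\<close> of a structure glued at \<open>r\<close>; the vertices over \<open>r\<close> at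
  which \<open>A\<close> (resp. \<open>B\<close>) does not lift are \<open>X2\<close> (resp. \<open>Y2\<close>). Gluing copies of \<open>P\<close> and \<open>Q\<close> along
  \<open>X2 \<union> Y2\<close> in all possible ways does not create a section.\<close>

lemma amalgam:
  assumes A: "is_struc sig ar A" and B: "is_struc sig ar B"
    and AB: "verts A \<inter> verts B = {r}" "\<And>R. rels A R \<inter> rels B R = {}"
    and P: "obstruction sig ar A r P f X1 X2" and Q: "obstruction sig ar B r Q f' Y1 Y2"
  obtains S F where "is_struc sig ar S" "is_hom sig S (join A B) F"
    "\<not> (\<exists>g. is_section sig (join A B) S F g)"
    "\<And>D h. is_hom sig S D h \<Longrightarrow> \<exists>U W. U \<subseteq> verts D \<and> W \<subseteq> verts D \<and>
       \<not> refutes sig D U W P X1 X2 \<and> \<not> refutes sig D W U Q Y1 Y2"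
proof -
  note sP = P[unfolded obstruction_def, THEN conjunct1]
  note sQ = Q[unfolded obstruction_def, THEN conjunct1]
  have f: "is_hom sig P A f" and X: "X1 \<union> X2 = {p \<in> verts P. f p = r}" "X1 \<inter> X2 = {}"
    and failA: "\<And>x g. x \<in> X2 \<Longrightarrow> is_section sig A P f g \<Longrightarrow> g r \<noteq> x"
    using P unfolding obstruction_def by blast+
  have f': "is_hom sig Q B f'" and Y: "Y1 \<union> Y2 = {p \<in> verts Q. f' p = r}" "Y1 \<inter> Y2 = {}"
    and failB: "\<And>x g. x \<in> Y2 \<Longrightarrow> is_section sig B Q f' g \<Longrightarrow> g r \<noteq> x"
    using Q unfolding obstruction_def by blast+
  have X': "X2 \<union> X1 = {p \<in> verts P. f p = r}" "X2 \<inter> X1 = {}"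
    and Y': "Y2 \<union> Y1 = {p \<in> verts Q. f' p = r}" "Y2 \<inter> Y1 = {}"
    using X Y by blast+
  have "finite (X1 \<union> X2)" "finite (Y1 \<union> Y2)"
    unfolding X(1) Y(1) using is_strucD(1)[OF sP] is_strucD(1)[OF sQ] by simp_all
  then have fin: "finite X1" "finite X2" "finite Y1" "finite Y2" by simp_all
  \<comment> \<open>There is a copy of \<open>P\<close> for every way of gluing \<open>X1\<close>
    into \<open>Y2\<close>, and below a copy of \<open>Q\<close> for every way of gluing
    \<open>Y1\<close> into \<open>X2\<close>.\<close>
  obtain n :: nat and c where c: "c ` {..<n} = X1 \<rightarrow>\<^sub>E Y2" using finite_enumerate_PiE[OF fin(1,4)] by blast
  obtain m :: nat and d where d: "d ` {..<m} = Y1 \<rightarrow>\<^sub>E X2" using finite_enumerate_PiE[OF fin(3,2)] by blast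
  have cY: "c k x \<in> Y2" if "k < n" "x \<in> X1" for k x using c that by (auto dest: equalityD1)
  have dX: "d k x \<in> X2" if "k < m" "x \<in> Y1" for k x using d that by (auto dest: equalityD1)
  define i where "i = attach 2 3 0 X2 X1 c"
  define j where "j = attach 3 2 1 Y2 Y1 d"
  define S where "S = \<lparr>verts = tag 2 0 ` X2 \<union> tag 3 0 ` Y2 \<union> (\<Union>k<n. i k ` verts P) \<union> (\<Union>k<m. j k ` verts Q),
    rels = (\<lambda>R. (\<Union>k<n. map (i k) ` rels P R) \<union> (\<Union>k<m. map (j k) ` rels Q R))\<rparr>"
  define F where "F v = (if tag_of v = 0 then f (untag v) else if tag_of v = 1 then f' (untag v) else r)" for v
  have Fi: "F (i k p) = f p" if "p \<in> verts P" for k p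
    using X that by (auto simp: F_def i_def attach_def)
  have Fj: "F (j k q) = f' q" if "q \<in> verts Q" for k q
    using Y that by (auto simp: F_def j_def attach_def)
  have mFi: "map F (map (i k) ps) = map f ps" if "ps \<in> rels P R" for k ps R
    using Fi is_strucD(4)[OF sP that] by simp
  have mFj: "map F (map (j k) qs) = map f' qs" if "qs \<in> rels Q R" for k qs R
    using Fj is_strucD(4)[OF sQ that] by simp
  have iS: "is_hom sig P S (i k)" if "k < n" for k
    using that by (intro is_homI) (auto simp: S_def)
  have jS: "is_hom sig Q S (j k)" if "k < m" for k
    using that by (intro is_homI) (auto simp: S_def)
  have vS: "v \<in> verts S \<Longrightarrow> (\<exists>x\<in>X2. v = tag 2 0 x) \<or> (\<exists>y\<in>Y2. v = tag 3 0 y) \<or>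
      (\<exists>k<n. \<exists>p\<in>verts P. v = i k p) \<or> (\<exists>k<m. \<exists>q\<in>verts Q. v = j k q)" for v
    by (auto simp: S_def)
  have rS: "xs \<in> rels S R \<Longrightarrow> (\<exists>k<n. \<exists>ps\<in>rels P R. xs = map (i k) ps) \<or>
      (\<exists>k<m. \<exists>qs\<in>rels Q R. xs = map (j k) qs)" for xs R
    by (auto simp: S_def)
  have r: "r \<in> verts A" "r \<in> verts B" using AB(1) by auto
  have strS: "is_struc sig ar S"
  proof (rule is_strucI)
    show "finite (verts S)"
      using fin is_strucD(1)[OF sP] is_strucD(1)[OF sQ] by (simp add: S_def)
    fix R xs assume "xs \<in> rels S R"
    then consider k ps where "k < n" "ps \<in> rels P R" "xs = map (i k) ps"
      | k qs where "k < m" "qs \<in> rels Q R" "xs = map (j k) qs"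
      using rS by blast
    then show "R \<in> sig \<and> length xs = ar R \<and> set xs \<subseteq> verts S"
    proof cases
      case 1
      then show ?thesis using is_strucD(2-4)[OF sP 1(2)] by (auto intro: is_homD(1)[OF iS[OF 1(1)]])
    next
      case 2
      then show ?thesis using is_strucD(2-4)[OF sQ 2(2)] by (auto intro: is_homD(1)[OF jS[OF 2(1)]])
    qed
  qed
  moreover have "is_hom sig S (join A B) F"
  proof (rule is_homI)
    fix v assume "v \<in> verts S"
    from vS[OF this] show "F v \<in> verts (join A B)"
      using r Fi Fj is_homD(1)[OF f] is_homD(1)[OF f'] by (auto simp: F_def[of "tag _ _ _"])
  next
    fix R xs assume R: "R \<in> sig" "xs \<in> rels S R"
    from rS[OF R(2)] show "map F xs \<in> rels (join A B) R"
    proof (elim disjE exE conjE bexE)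
      fix k ps assume "ps \<in> rels P R" "xs = map (i k) ps"
      then show ?thesis using mFi is_homD(2)[OF f R(1)] by (simp only:) simp
    next
      fix k qs assume "qs \<in> rels Q R" "xs = map (j k) qs"
      then show ?thesis using mFj is_homD(2)[OF f' R(1)] by (simp only:) simp
    qed
  qed
  moreover have "\<not> (\<exists>g. is_section sig (join A B) S F g)"
  proof
    assume "\<exists>g. is_section sig (join A B) S F g"
    then obtain g where g: "is_hom sig (join A B) S g" and Fg: "\<And>v. v \<in> verts A \<union> verts B \<Longrightarrow> F (g v) = v"
      unfolding is_section_def by auto
    have mFgA: "map F (map g xs) = xs" if "xs \<in> rels A R" for xs R
      using Fg is_strucD(4)[OF A that] by (simp add: map_idI)
    have mFgB: "map F (map g xs) = xs" if "xs \<in> rels B R" for xs R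
      using Fg is_strucD(4)[OF B that] by (simp add: map_idI)
    \<comment> \<open>Copies of \<open>Q\<close> lie over \<open>B\<close>, so a section cannot use
      them at vertices of \<open>A\<close> other than \<open>r\<close>. For tuples, the disjointness
      of the relations gives the same below.\<close>
    have vA: "\<exists>k. \<exists>p\<in>verts P. f p = v \<and> g v = i k p" if v: "v \<in> verts A" "v \<noteq> r" for v
    proof -
      have "g v \<in> verts S" using is_homD(1)[OF g] v by simp
      from vS[OF this] show ?thesis
      proof (elim disjE exE conjE bexE)
        fix k q assume "q \<in> verts Q" "g v = j k q"
        then have "v \<in> verts B" using Fg[of v] Fj[of q k] is_homD(1)[OF f', of q] v by simp
        then show ?thesis using v AB(1) by blast
      next
        fix k p assume "p \<in> verts P" "g v = i k p"
        then show ?thesis using Fg[of v] Fi[of p k] v by auto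
      qed (use Fg[of v] v in \<open>simp_all add: F_def\<close>)
    qed
    have vB: "\<exists>k. \<exists>q\<in>verts Q. f' q = v \<and> g v = j k q" if v: "v \<in> verts B" "v \<noteq> r" for v
    proof -
      have "g v \<in> verts S" using is_homD(1)[OF g] v by simp
      from vS[OF this] show ?thesis
      proof (elim disjE exE conjE bexE)
        fix k p assume "p \<in> verts P" "g v = i k p"
        then have "v \<in> verts A" using Fg[of v] Fi[of p k] is_homD(1)[OF f, of p] v by simp
        then show ?thesis using v AB(1) by blast
      next
        fix k q assume "q \<in> verts Q" "g v = j k q"
        then show ?thesis using Fg[of v] Fj[of q k] v by auto
      qed (use Fg[of v] v in \<open>simp_all add: F_def\<close>)
    qed
    have tA: "\<exists>k. \<exists>ps\<in>rels P R. map f ps = xs \<and> map g xs = map (i k) ps"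
      if R: "R \<in> sig" "xs \<in> rels A R" for R xs
    proof -
      have "map g xs \<in> rels S R" using is_homD(2)[OF g R(1)] R(2) by simp
      from rS[OF this] show ?thesis
      proof (elim disjE exE conjE bexE)
        fix k ps assume "ps \<in> rels P R" "map g xs = map (i k) ps"
        then show ?thesis using mFgA[OF R(2)] mFi by metis
      next
        fix k qs assume "qs \<in> rels Q R" "map g xs = map (j k) qs"
        then have "xs \<in> rels B R" using mFgA[OF R(2)] mFj is_homD(2)[OF f' R(1)] by metis
        then show ?thesis using R(2) AB(2) by blast
      qed
    qed
    have tB: "\<exists>k. \<exists>qs\<in>rels Q R. map f' qs = xs \<and> map g xs = map (j k) qs"
      if R: "R \<in> sig" "xs \<in> rels B R" for R xs
    proof -
      have "map g xs \<in> rels S R" using is_homD(2)[OF g R(1)] R(2) by simp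
      from rS[OF this] show ?thesis
      proof (elim disjE exE conjE bexE)
        fix k qs assume "qs \<in> rels Q R" "map g xs = map (j k) qs"
        then show ?thesis using mFgB[OF R(2)] mFj by metis
      next
        fix k ps assume "ps \<in> rels P R" "map g xs = map (i k) ps"
        then have "xs \<in> rels A R" using mFgB[OF R(2)] mFi is_homD(2)[OF f R(1)] by metis
        then show ?thesis using R(2) AB(2) by blast
      qed
    qed
    \<comment> \<open>The vertices over \<open>r\<close> are exactly the shared ones, and through
      these \<open>A\<close> or \<open>B\<close> respectively does not lift.\<close>
    have "(\<exists>x\<in>X2. g r = tag 2 0 x) \<or> (\<exists>y\<in>Y2. g r = tag 3 0 y)"
    proof -
      have "g r \<in> verts S" using is_homD(1)[OF g] r by simp
      from vS[OF this] show ?thesis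
      proof (elim disjE exE conjE bexE)
        fix k p assume k: "k < n" and p: "p \<in> verts P" "g r = i k p"
        then have "p \<in> X1 \<union> X2" using Fg[of r] Fi[OF p(1)] r X(1) by simp
        then show ?thesis using p(2) cY[OF k] by (auto simp: i_def attach_def)
      next
        fix k q assume k: "k < m" and q: "q \<in> verts Q" "g r = j k q"
        then have "q \<in> Y1 \<union> Y2" using Fg[of r] Fj[OF q(1)] r Y(1) by simp
        then show ?thesis using q(2) dX[OF k] by (auto simp: j_def attach_def)
      qed blast+
    qed
    then show False
    proof (elim disjE bexE)
      fix x assume x: "x \<in> X2" "g r = tag 2 0 x"
      show False
        using section_project[OF A f X' _ r(1) x vA[unfolded i_def] tA[unfolded i_def]] failA[OF x(1)] by fastforce
    next
      fix y assume y: "y \<in> Y2" "g r = tag 3 0 y"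
      show False
        using section_project[OF B f' Y' _ r(2) y vB[unfolded j_def] tB[unfolded j_def]] failB[OF y(1)] by fastforce
    qed
  qed
  moreover have "\<exists>U W. U \<subseteq> verts D \<and> W \<subseteq> verts D \<and>
       \<not> refutes sig D U W P X1 X2 \<and> \<not> refutes sig D W U Q Y1 Y2" if h: "is_hom sig S D h" for D h
  proof -
    \<comment> \<open>The colours that \<open>h\<close> uses on the shared vertices. On
      \<open>X2\<close> all copies of \<open>P\<close> agree, while their colourings of
      \<open>X1\<close> exhaust those by \<open>U\<close>. If \<open>Y2\<close> is empty and
      \<open>X1\<close> is not, there are no copies of \<open>P\<close>, but \<open>U\<close> is
      then empty and nothing has to be extended.\<close>
    define U where "U = (\<lambda>y. h (tag 3 0 y)) ` Y2"
    define W where "W = (\<lambda>x. h (tag 2 0 x)) ` X2"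
    have "U \<subseteq> verts D" "W \<subseteq> verts D"
      using is_homD(1)[OF h] by (auto simp: U_def W_def S_def)
    moreover have "\<not> refutes sig D U W P X1 X2"
    proof -
      have "\<exists>h'. is_hom sig P D h' \<and> (\<forall>x\<in>X2. h' x = h (tag 2 0 x)) \<and> (\<forall>x\<in>X1. h' x = z x)"
        if z: "z ` X1 \<subseteq> U" for z
      proof -
        obtain k where k: "k < n" "\<And>x. x \<in> X1 \<Longrightarrow> h (tag 3 0 (c k x)) = z x"
          using lift_through_enumeration[OF c z[unfolded U_def]] by blast
        show ?thesis
          by (rule exI[of _ "h \<circ> i k"])
            (use is_hom_comp[OF iS[OF k(1)] h] k(2) X(2) in \<open>auto simp: i_def attach_def\<close>)
      qed
      then show ?thesis unfolding refutes_def W_def by blast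
    qed
    moreover have "\<not> refutes sig D W U Q Y1 Y2"
    proof -
      have "\<exists>h'. is_hom sig Q D h' \<and> (\<forall>x\<in>Y2. h' x = h (tag 3 0 x)) \<and> (\<forall>x\<in>Y1. h' x = z x)"
        if z: "z ` Y1 \<subseteq> W" for z
      proof -
        obtain k where k: "k < m" "\<And>x. x \<in> Y1 \<Longrightarrow> h (tag 2 0 (d k x)) = z x"
          using lift_through_enumeration[OF d z[unfolded W_def]] by blast
        show ?thesis
          by (rule exI[of _ "h \<circ> j k"])
            (use is_hom_comp[OF jS[OF k(1)] h] k(2) Y(2) in \<open>auto simp: j_def attach_def\<close>)
      qed
      then show ?thesis unfolding refutes_def U_def by blast
    qed
    ultimately show ?thesis by blast
  qed
  ultimately show ?thesis using that by blast
qed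

section \<open>Regularity\<close>

text \<open>If some member of the family mapped to the exchanged structure without a section, the part of it over \<open>A'\<close> could be
  traded for a structure over \<open>A\<close> with the same refutations, and the amalgam would contradict
  the existence of sections over \<open>join A B\<close>.\<close>

lemma exchange:
  assumes dual: "duality_pair sig ar Ob Ds" and cores: "\<forall>T\<in>Ob. is_core sig ar T"
    and anti: "antichain sig Ob"
    and A: "is_struc sig ar A" and A': "is_struc sig ar A'" and B: "is_struc sig ar B"
    and AB: "verts A \<inter> verts B = {r}" "\<And>R. rels A R \<inter> rels B R = {}"
    and A'B: "verts A' \<inter> verts B = {r}" "\<And>R. rels A' R \<inter> rels B R = {}"
    and targets: "root_targets sig Ds A r = root_targets sig Ds A' r"
    and obstr: "obstruction_types sig ar Ds A r = obstruction_types sig ar Ds A' r"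
    and fam: "in_fam sig (join A B) Ob"
  shows "in_fam sig (join A' B) Ob"
proof -
  have r: "r \<in> verts A" "r \<in> verts A'" "r \<in> verts B" using AB(1) A'B(1) by auto
  \<comment> \<open>Equal root targets allow the restriction to \<open>A'\<close> of such a
    homomorphism to be replaced by one on \<open>A\<close> with the same value at the root, and
    \<open>join A B\<close> would map to a dual.\<close>
  have "\<not> hom_to sig (join A' B) D" if D: "D \<in> Ds" for D
  proof
    assume "hom_to sig (join A' B) D"
    then obtain h where h: "is_hom sig (join A' B) D h" unfolding hom_to_def ..
    have hA': "is_hom sig A' D h" and hB: "is_hom sig B D h"
      using is_homD[OF h] by (simp_all add: is_hom_def image_subset_iff)
    have "(D, h r) \<in> root_targets sig Ds A' r" unfolding root_targets_def using D hA' by blast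
    then have "(D, h r) \<in> root_targets sig Ds A r" using targets by simp
    then obtain h' where h': "is_hom sig A D h'" "h' r = h r"
      unfolding root_targets_def by force
    have "is_hom sig (join A B) D (\<lambda>v. if v \<in> verts A then h' v else h v)"
    proof (rule is_hom_join[OF A B h'(1) hB])
      fix v assume "v \<in> verts A" "v \<in> verts B"
      then have "v = r" using AB(1) by blast
      then show "h' v = h v" using h'(2) by simp
    qed
    then show False
      using in_fam_not_hom[OF dual is_struc_join[OF A B] fam D] unfolding hom_to_def by blast
  qed
  then obtain T f where T: "T \<in> Ob" and f: "is_hom sig T (join A' B) f"
    using dual is_struc_join[OF A' B] unfolding duality_pair_def hom_to_def by blast
  have coreT: "is_core sig ar T" using cores T by blast
  then have sT: "is_struc sig ar T" by (simp add: is_core_def)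
  have "\<exists>g. is_section sig (join A' B) T f g"
  proof (rule ccontr)
    assume no: "\<nexists>g. is_section sig (join A' B) T f g"
    define P where "P = preimage_struc T f A'"
    define Q where "Q = preimage_struc T f B"
    define X where "X = {s \<in> verts T. f s = r}"
    define X2 where "X2 = {x \<in> X. \<not> (\<exists>g. is_section sig A' P f g \<and> g r = x)}"
    define X1 where "X1 = X - X2"
    have sP: "is_struc sig ar P" and sQ: "is_struc sig ar Q"
      unfolding P_def Q_def using is_struc_preimage sT A' B by blast+
    have XP: "X = {p \<in> verts P. f p = r}" and XQ: "X = {q \<in> verts Q. f q = r}"
      using r by (auto simp: X_def P_def Q_def)
    have XX: "X1 \<union> X2 = X" "X1 \<inter> X2 = {}" by (auto simp: X1_def X2_def)
    have obsP: "obstruction sig ar A' r P f X1 X2"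
      unfolding obstruction_def XX XP[symmetric]
      using sP is_hom_preimage[of sig T f A'] by (auto simp: P_def[symmetric] X2_def)
    \<comment> \<open>A vertex of \<open>X1\<close> is met by a section over \<open>A'\<close>. A
      section over \<open>B\<close> through it would agree with that one at \<open>r\<close>, and
      together they would be a section over the whole.\<close>
    have failB: "\<not> (\<exists>g. is_section sig B Q f g \<and> g r = x)" if x: "x \<in> X1" for x
    proof
      assume "\<exists>g. is_section sig B Q f g \<and> g r = x"
      then obtain g2 where g2: "is_section sig B Q f g2" "g2 r = x" by blast
      obtain g1 where g1: "is_section sig A' P f g1" "g1 r = x"
        using x by (auto simp: X1_def X2_def)
      have hg1: "is_hom sig A' T g1"
        using is_hom_comp[of sig A' P g1 T id] g1 is_hom_preimage_incl[of sig T f A']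
        by (simp add: is_section_def P_def)
      have hg2: "is_hom sig B T g2"
        using is_hom_comp[of sig B Q g2 T id] g2 is_hom_preimage_incl[of sig T f B]
        by (simp add: is_section_def Q_def)
      have "is_hom sig (join A' B) T (\<lambda>v. if v \<in> verts A' then g1 v else g2 v)"
      proof (rule is_hom_join[OF A' B hg1 hg2])
        fix v assume "v \<in> verts A'" "v \<in> verts B"
        then have "v = r" using A'B(1) by blast
        then show "g1 v = g2 v" using g1(2) g2(2) by simp
      qed
      then have "is_section sig (join A' B) T f (\<lambda>v. if v \<in> verts A' then g1 v else g2 v)"
        using g1(1) g2(1) by (auto simp: is_section_def)
      then show False using no by blast
    qed
    have obsQ: "obstruction sig ar B r Q f X2 X1"
      unfolding obstruction_def XQ[symmetric]
      using sQ is_hom_preimage[of sig T f B] XX failB by (auto simp: Q_def[symmetric])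
    have "refutations sig Ds P X1 X2 \<in> obstruction_types sig ar Ds A' r"
      unfolding obstruction_types_def using obsP by blast
    then have "refutations sig Ds P X1 X2 \<in> obstruction_types sig ar Ds A r" using obstr by simp
    then obtain P' f' Z1 Z2 where ref: "refutations sig Ds P' Z1 Z2 = refutations sig Ds P X1 X2"
      and obsP': "obstruction sig ar A r P' f' Z1 Z2"
      unfolding obstruction_types_def by (auto simp: eq_commute)
    obtain S F where S: "is_struc sig ar S" "is_hom sig S (join A B) F"
      "\<nexists>g. is_section sig (join A B) S F g"
      and ext: "\<And>D h. is_hom sig S D h \<Longrightarrow> \<exists>U W. U \<subseteq> verts D \<and> W \<subseteq> verts D \<and>
         \<not> refutes sig D U W P' Z1 Z2 \<and> \<not> refutes sig D W U Q X2 X1"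
      by (rule amalgam[OF A B AB obsP' obsQ]) blast
    have "\<not> hom_to sig S D" if D: "D \<in> Ds" for D
    proof
      assume "hom_to sig S D"
      then obtain h where "is_hom sig S D h" unfolding hom_to_def ..
      from ext[OF this] obtain U W where UW: "U \<subseteq> verts D" "W \<subseteq> verts D"
        "\<not> refutes sig D U W P' Z1 Z2" "\<not> refutes sig D W U Q X2 X1"
        by blast
      have "(D, U, W) \<notin> refutations sig Ds P' Z1 Z2"
        unfolding refutations_def using UW(3) by blast
      then have "(D, U, W) \<notin> refutations sig Ds P X1 X2" using ref by simp
      then have "\<not> refutes sig D U W P X1 X2" using D UW(1,2) by (simp add: refutations_def)
      then obtain w where w: "w ` X2 \<subseteq> W" "\<And>c. c ` X1 \<subseteq> U \<Longrightarrow>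
          \<exists>h. is_hom sig P D h \<and> (\<forall>x\<in>X2. h x = w x) \<and> (\<forall>x\<in>X1. h x = c x)"
        unfolding refutes_def by blast
      obtain c where c: "c ` X1 \<subseteq> U" "\<And>w. w ` X2 \<subseteq> W \<Longrightarrow>
          \<exists>h. is_hom sig Q D h \<and> (\<forall>x\<in>X1. h x = c x) \<and> (\<forall>x\<in>X2. h x = w x)"
        using UW(4) unfolding refutes_def by blast
      obtain h1 where h1: "is_hom sig P D h1" "\<forall>x\<in>X2. h1 x = w x" "\<forall>x\<in>X1. h1 x = c x"
        using w(2)[OF c(1)] by blast
      obtain h2 where h2: "is_hom sig Q D h2" "\<forall>x\<in>X1. h2 x = c x" "\<forall>x\<in>X2. h2 x = w x"
        using c(2)[OF w(1)] by blast
      \<comment> \<open>\<open>P\<close> and \<open>Q\<close> meet only in the fibre, where both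
        homomorphisms follow \<open>w\<close> and \<open>c\<close>; so they combine to a map of all
        of \<open>T\<close> to a dual.\<close>
      have hj: "is_hom sig (join P Q) D (\<lambda>v. if v \<in> verts P then h1 v else h2 v)"
      proof (rule is_hom_join[OF sP sQ h1(1) h2(1)])
        fix v assume "v \<in> verts P" "v \<in> verts Q"
        then have "v \<in> X" using A'B(1) by (auto simp: P_def Q_def X_def)
        then show "h1 v = h2 v" using h1 h2 XX(1) by auto
      qed
      have "is_hom sig T (join P Q) id"
        using is_homD[OF f] by (intro is_homI) (auto simp: P_def Q_def)
      from is_hom_comp[OF this hj] have "hom_to sig T D" unfolding hom_to_def by blast
      moreover have "is_hom sig T T id" by (rule is_homI) auto
      ultimately show False
        using dual sT T D unfolding duality_pair_def hom_to_def by blast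
    qed
    from in_fam_section[OF dual cores anti is_struc_join[OF A B] fam S(1,2) this] S(3)
    show False by blast
  qed
  then show ?thesis using section_in_fam[OF coreT T f] by blast
qed

section \<open>Invariance under renaming of vertices\<close>

lemma image_struc_inv:
  assumes "is_struc sig ar A" "inj_on f (verts A)"
  shows "image_struc (inv_into (verts A) f) (image_struc f A) = A"
proof -
  have inv: "inv_into (verts A) f (f v) = v" if "v \<in> verts A" for v
    using assms(2) that by simp
  have "map (inv_into (verts A) f) ` map f ` rels A R = rels A R" for R
  proof -
    have "map (inv_into (verts A) f) (map f xs) = xs" if "xs \<in> rels A R" for xs
      using inv is_strucD(4)[OF assms(1) that] by (simp add: map_idI)
    then show ?thesis unfolding image_image by (simp add: image_def)
  qed
  moreover have "inv_into (verts A) f ` f ` verts A = verts A"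
    unfolding image_image using inv by simp
  ultimately show ?thesis by (simp add: image_struc_def)
qed

lemma is_hom_image_inv:
  assumes "is_struc sig ar A" "inj_on f (verts A)"
  shows "is_hom sig (image_struc f A) A (inv_into (verts A) f)"
  using is_hom_image[of sig "image_struc f A" "inv_into (verts A) f"]
  unfolding image_struc_inv[OF assms] .

lemma root_targets_image:
  assumes A: "is_struc sig ar A" "inj_on f (verts A)" "a \<in> verts A"
  shows "root_targets sig Ds (image_struc f A) (f a) = root_targets sig Ds A a"
proof
  show "root_targets sig Ds (image_struc f A) (f a) \<subseteq> root_targets sig Ds A a"
  proof
    fix z assume "z \<in> root_targets sig Ds (image_struc f A) (f a)"
    then obtain D h where z: "z = (D, (h \<circ> f) a)" "D \<in> Ds" "is_hom sig (image_struc f A) D h"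
      unfolding root_targets_def by auto
    show "z \<in> root_targets sig Ds A a"
      unfolding root_targets_def z(1) using z(2) is_hom_comp[OF is_hom_image z(3)] by blast
  qed
  show "root_targets sig Ds A a \<subseteq> root_targets sig Ds (image_struc f A) (f a)"
  proof
    fix z assume "z \<in> root_targets sig Ds A a"
    then obtain D h where z: "z = (D, h a)" "D \<in> Ds" "is_hom sig A D h"
      unfolding root_targets_def by blast
    have "is_hom sig (image_struc f A) D (h \<circ> inv_into (verts A) f)"
      by (rule is_hom_comp[OF is_hom_image_inv[OF A(1,2)] z(3)])
    moreover have "(h \<circ> inv_into (verts A) f) (f a) = h a" using A by simp
    ultimately show "z \<in> root_targets sig Ds (image_struc f A) (f a)"
      unfolding root_targets_def z(1) using z(2) by (metis (mono_tags, lifting) mem_Collect_eq)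
  qed
qed

lemma obstruction_types_image_subset:
  assumes A: "is_struc sig ar A" "inj_on f (verts A)" "a \<in> verts A"
  shows "obstruction_types sig ar Ds A a \<subseteq> obstruction_types sig ar Ds (image_struc f A) (f a)"
proof
  fix z assume "z \<in> obstruction_types sig ar Ds A a"
  then obtain P p X1 X2 where z: "z = refutations sig Ds P X1 X2"
    and obs: "obstruction sig ar A a P p X1 X2"
    unfolding obstruction_types_def by blast
  have p: "is_hom sig P A p" using obs by (simp add: obstruction_def)
  have "{q \<in> verts P. (f \<circ> p) q = f a} = {q \<in> verts P. p q = a}"
    using is_homD(1)[OF p] A(2,3) by (auto dest: inj_onD)
  moreover have "is_section sig A P p (g \<circ> f)"
    if g: "is_section sig (image_struc f A) P (f \<circ> p) g" for g
  proof -
    have gh: "is_hom sig (image_struc f A) P g" using g by (simp add: is_section_def)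
    have "p (g (f v)) = v" if v: "v \<in> verts A" for v
    proof -
      have "f (p (g (f v))) = f v" using g v by (auto simp: is_section_def)
      moreover have "p (g (f v)) \<in> verts A" using is_homD(1)[OF p] is_homD(1)[OF gh] v by simp
      ultimately show ?thesis using inj_onD[OF A(2)] v by metis
    qed
    then show ?thesis using is_hom_comp[OF is_hom_image gh] by (simp add: is_section_def)
  qed
  ultimately have "obstruction sig ar (image_struc f A) (f a) P (f \<circ> p) X1 X2"
    using obs is_hom_comp[OF p is_hom_image[of sig A f]] unfolding obstruction_def
    by (metis (no_types, lifting) comp_apply)
  then show "z \<in> obstruction_types sig ar Ds (image_struc f A) (f a)"
    unfolding z obstruction_types_def by blast
qed

lemma obstruction_types_image:
  assumes A: "is_struc sig ar A" "inj_on f (verts A)" "a \<in> verts A"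
  shows "obstruction_types sig ar Ds (image_struc f A) (f a) = obstruction_types sig ar Ds A a"
proof
  show "obstruction_types sig ar Ds A a \<subseteq> obstruction_types sig ar Ds (image_struc f A) (f a)"
    by (rule obstruction_types_image_subset[OF A])
  have "inj_on (inv_into (verts A) f) (verts (image_struc f A))"
    by (simp add: inj_on_inv_into)
  from obstruction_types_image_subset[OF is_struc_image[OF A(1)] this, of "f a" Ds]
  show "obstruction_types sig ar Ds (image_struc f A) (f a) \<subseteq> obstruction_types sig ar Ds A a"
    unfolding image_struc_inv[OF A(1,2)] using A by simp
qed

lemma replicate_root_if_shared:
  assumes "is_struc sig ar A" "is_struc sig ar B" "xs \<in> rels A R" "xs \<in> rels B R"
    and "verts A \<inter> verts B = {r}"
  shows "xs = replicate (ar R) r"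
proof (rule replicate_eqI)
  show "length xs = ar R" using is_strucD(3)[OF assms(1,3)] .
  fix y assume "y \<in> set xs"
  then show "y = r"
    using is_strucD(4)[OF assms(1,3)] is_strucD(4)[OF assms(2,4)] assms(5) by blast
qed

lemma root_rels_image:
  assumes A: "is_struc sig ar A" "inj_on f (verts A)" "a \<in> verts A"
  shows "root_rels sig ar (image_struc f A) (f a) = root_rels sig ar A a"
proof -
  have "replicate n (f a) \<in> map f ` rels A R \<longleftrightarrow> replicate n a \<in> rels A R" for n R
  proof
    assume "replicate n a \<in> rels A R"
    then have "map f (replicate n a) \<in> map f ` rels A R" by (rule imageI)
    then show "replicate n (f a) \<in> map f ` rels A R" by simp
  next
    assume "replicate n (f a) \<in> map f ` rels A R"
    then obtain ys where ys: "ys \<in> rels A R" "map f ys = replicate n (f a)" by auto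
    have len: "length ys = n" using arg_cong[OF ys(2), of length] by simp
    have "ys = replicate n a"
    proof (rule replicate_eqI[OF len])
      fix y assume y: "y \<in> set ys"
      then have "f y \<in> set (replicate n (f a))" unfolding ys(2)[symmetric] by simp
      then have "f y = f a" by (simp split: if_splits)
      then show "y = a" using inj_onD[OF A(2)] A(3) is_strucD(4)[OF A(1) ys(1) y] by blast
    qed
    then show "replicate n a \<in> rels A R" using ys(1) by simp
  qed
  then show ?thesis by (simp add: root_rels_def)
qed

text \<open>What remains after \<open>exchange\<close> is bookkeeping: the halves are realised
  inside the glued structure, with tuples at the root counted in only one of them.\<close>

lemma quot_fam_subset:
  assumes dual: "duality_pair sig ar Ob Ds" and cores: "\<forall>T\<in>Ob. is_core sig ar T"
    and anti: "antichain sig Ob"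
    and A: "is_rooted_forest sig ar (A, a)" and A': "is_rooted_forest sig ar (A', a')"
    and targets: "root_targets sig Ds A a = root_targets sig Ds A' a'"
    and rrels: "root_rels sig ar A a = root_rels sig ar A' a'"
    and obstr: "obstruction_types sig ar Ds A a = obstruction_types sig ar Ds A' a'"
  shows "quot_fam sig ar Ob (A, a) \<subseteq> quot_fam sig ar Ob (A', a')"
proof
  fix Bb assume Bb: "Bb \<in> quot_fam sig ar Ob (A, a)"
  obtain B b where Bb_eq: "Bb = (B, b)" by fastforce
  have rf: "is_rooted_forest sig ar (B, b)" using Bb by (simp add: quot_fam_def Bb_eq)
  have sA: "is_struc sig ar A" "a \<in> verts A" and sA': "is_struc sig ar A'" "a' \<in> verts A'"
    and sB: "is_struc sig ar B" "b \<in> verts B"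
    using A A' rf by (auto simp: is_rooted_forest_def is_forest_def)
  obtain C where glue: "is_glue sig C (A, a) (B, b)" and fam: "in_fam sig C Ob"
    using Bb by (auto simp: quot_fam_def Bb_eq)
  from glue obtain \<alpha> \<beta> where \<alpha>: "inj_on \<alpha> (verts A)" and \<beta>: "inj_on \<beta> (verts B)" and ab: "\<alpha> a = \<beta> b"
    and vC: "\<alpha> ` verts A \<union> \<beta> ` verts B = verts C" "\<alpha> ` verts A \<inter> \<beta> ` verts B = {\<alpha> a}"
    and rC: "\<forall>R\<in>sig. rels C R = map \<alpha> ` rels A R \<union> map \<beta> ` rels B R"
    "\<forall>R. R \<notin> sig \<longrightarrow> rels C R = {}"
    unfolding is_glue_def by auto
  define r where "r = \<alpha> a"
  define A1 where "A1 = image_struc \<alpha> A"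
  define B0 where "B0 = image_struc \<beta> B"
  \<comment> \<open>Shared tuples are assigned to \<open>A1\<close>, because \<open>exchange\<close>
    wants disjoint relations.\<close>
  define B1 where "B1 = \<lparr>verts = verts B0, rels = (\<lambda>R. rels B0 R - rels A1 R)\<rparr>"
  have B1: "verts B1 = verts B0" "\<And>R. rels B1 R = rels B0 R - rels A1 R"
    by (simp_all add: B1_def)
  have sA1: "is_struc sig ar A1" and sB0: "is_struc sig ar B0"
    unfolding A1_def B0_def using is_struc_image sA sB by blast+
  have sB1: "is_struc sig ar B1"
    using is_strucD[OF sB0] by (intro is_strucI) (auto simp: B1)
  have finC: "finite (verts C)"
    using is_strucD(1)[OF sA1] is_strucD(1)[OF sB0] vC(1) by (simp add: A1_def B0_def flip: vC(1))
  then obtain M where M: "\<forall>v\<in>verts C. v < M" using finite_nat_set_iff_bounded by blast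
  have rC': "r \<in> verts C" using vC sA(2) by (auto simp: r_def)
  \<comment> \<open>The new half meets the old structure only in \<open>r\<close>: all its other
    vertices are moved to numbers from \<open>M\<close> on.\<close>
  define \<alpha>' where "\<alpha>' v = (if v = a' then r else v + M)" for v
  have \<alpha>': "inj_on \<alpha>' (verts A')" using M rC' by (auto simp: inj_on_def \<alpha>'_def)
  have ra': "\<alpha>' a' = r" by (simp add: \<alpha>'_def)
  define A1' where "A1' = image_struc \<alpha>' A'"
  have sA1': "is_struc sig ar A1'" unfolding A1'_def using is_struc_image[OF sA'(1)] .
  have vAB: "verts A1 \<inter> verts B0 = {r}" using vC(2) by (simp add: A1_def B0_def r_def)
  have rB0: "r \<in> verts B0" using vAB by blast
  have B0C: "verts B0 \<subseteq> verts C" using vC(1) by (auto simp: B0_def)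
  have vA'B: "verts A1' \<inter> verts B0 = {r}"
  proof
    show "verts A1' \<inter> verts B0 \<subseteq> {r}" using M B0C by (force simp: A1'_def \<alpha>'_def)
    show "{r} \<subseteq> verts A1' \<inter> verts B0" using rB0 ra' sA'(2) by (force simp: A1'_def)
  qed
  have rr: "root_rels sig ar A1 r = root_rels sig ar A1' r"
    using root_rels_image[OF sA(1) \<alpha> sA(2)] root_rels_image[OF sA'(1) \<alpha>' sA'(2)] rrels
    by (simp add: A1_def A1'_def r_def ra')
  \<comment> \<open>The tuples removed from \<open>B0\<close> are supplied again by
    \<open>A1'\<close>, since they consist of the root alone and \<open>root_rels\<close> is the
    same for both halves.\<close>
  have shared: "xs \<in> rels A1' R \<longleftrightarrow> xs \<in> rels A1 R"
    if xs: "xs \<in> rels B0 R" "xs \<in> rels A1 R \<or> xs \<in> rels A1' R" for xs R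
  proof -
    have "xs = replicate (ar R) r"
      using xs replicate_root_if_shared[OF sA1 sB0 _ _ vAB] replicate_root_if_shared[OF sA1' sB0 _ _ vA'B]
      by blast
    then show ?thesis using rr is_strucD(2)[OF sB0 xs(1)] by (auto simp: root_rels_def)
  qed
  have "join A1 B1 = C"
  proof -
    have "rels A1 R \<union> rels B1 R = rels C R" for R
    proof (cases "R \<in> sig")
      case True
      then show ?thesis using rC(1) by (auto simp: A1_def B0_def B1)
    next
      case False
      then show ?thesis using rC(2) is_strucD(2)[OF sA1] is_strucD(2)[OF sB1] by blast
    qed
    moreover have "verts A1 \<union> verts B1 = verts C" using vC(1) by (simp add: B1 A1_def B0_def)
    ultimately show ?thesis by (simp add: join_def)
  qed
  then have "in_fam sig (join A1 B1) Ob" using fam by simp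
  then have fam': "in_fam sig (join A1' B1) Ob"
  proof (rule exchange[OF dual cores anti sA1 sA1' sB1, rotated -1])
    show "verts A1 \<inter> verts B1 = {r}" "verts A1' \<inter> verts B1 = {r}" using vAB vA'B by (simp_all add: B1)
    show "rels A1 R \<inter> rels B1 R = {}" for R by (auto simp: B1)
    show "rels A1' R \<inter> rels B1 R = {}" for R using shared by (auto simp: B1)
    show "root_targets sig Ds A1 r = root_targets sig Ds A1' r"
      using root_targets_image[OF sA(1) \<alpha> sA(2)] root_targets_image[OF sA'(1) \<alpha>' sA'(2)] targets
      by (simp add: A1_def A1'_def r_def ra')
    show "obstruction_types sig ar Ds A1 r = obstruction_types sig ar Ds A1' r"
      using obstruction_types_image[OF sA(1) \<alpha> sA(2)] obstruction_types_image[OF sA'(1) \<alpha>' sA'(2)] obstr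
      by (simp add: A1_def A1'_def r_def ra')
  qed
  have rels': "rels A1' R \<union> rels B1 R = rels A1' R \<union> rels B0 R" for R
    using shared by (auto simp: B1)
  have "is_glue sig (join A1' B1) (A', a') (B, b)"
    unfolding is_glue_def prod.case
  proof (intro exI conjI)
    show "inj_on \<alpha>' (verts A')" "inj_on \<beta> (verts B)" by fact+
    show "\<alpha>' a' = \<beta> b" using ra' ab by (simp add: r_def)
    show "\<alpha>' ` verts A' \<union> \<beta> ` verts B = verts (join A1' B1)" by (simp add: A1'_def B1 B0_def)
    show "\<alpha>' ` verts A' \<inter> \<beta> ` verts B = {\<alpha>' a'}" using vA'B by (simp add: A1'_def B0_def ra')
    show "\<forall>R\<in>sig. rels (join A1' B1) R = map \<alpha>' ` rels A' R \<union> map \<beta> ` rels B R"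
      unfolding rels_join rels' by (simp add: A1'_def B0_def)
    show "\<forall>R. R \<notin> sig \<longrightarrow> rels (join A1' B1) R = {}"
      using is_strucD(2)[OF is_struc_join[OF sA1' sB1]] by blast
  qed
  then show "Bb \<in> quot_fam sig ar Ob (A', a')"
    unfolding quot_fam_def Bb_eq using rf fam' by blast
qed

text \<open>The triple \<open>J\<close> ranges over a finite set built from the vertices of the
  duals and from \<open>sig\<close>, and by symmetry of \<open>quot_fam_subset\<close> the quotient
  is a function of it.\<close>

lemma duality_imp_regular:
  assumes dual: "duality_pair sig ar Ob Ds" and cores: "\<forall>T\<in>Ob. is_core sig ar T"
    and anti: "antichain sig Ob" and sig: "finite sig"
    and Ds: "finite Ds" "\<forall>D\<in>Ds. is_struc sig ar D"
  shows "regular sig ar Ob"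
proof -
  define J where "J = (\<lambda>(A, a). (root_targets sig Ds A a, root_rels sig ar A a, obstruction_types sig ar Ds A a))"
  define RF where "RF = {Aa. is_rooted_forest sig ar Aa}"
  define V where "V = (\<Union>D\<in>Ds. verts D)"
  have V: "finite V" using Ds is_strucD(1) by (auto simp: V_def)
  have "root_targets sig Ds A a \<subseteq> Ds \<times> V" if "a \<in> verts A" for A a
    using that is_homD(1) unfolding root_targets_def V_def by fast
  moreover have "obstruction_types sig ar Ds A a \<subseteq> Pow (Ds \<times> Pow V \<times> Pow V)" for A a
    unfolding obstruction_types_def refutations_def V_def by fast
  ultimately have "J ` RF \<subseteq> Pow (Ds \<times> V) \<times> Pow sig \<times> Pow (Pow (Ds \<times> Pow V \<times> Pow V))"
    by (force simp: J_def RF_def is_rooted_forest_def root_rels_def)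
  moreover have "finite (Pow (Ds \<times> V) \<times> Pow sig \<times> Pow (Pow (Ds \<times> Pow V \<times> Pow V)))"
    using V Ds(1) sig by blast
  ultimately have fin: "finite (J ` RF)" by (rule finite_subset)
  have "quot_fam sig ar Ob Aa \<subseteq> quot_fam sig ar Ob Bb" if "Aa \<in> RF" "Bb \<in> RF" "J Aa = J Bb" for Aa Bb
    using quot_fam_subset[OF dual cores anti, of "fst Aa" "snd Aa" "fst Bb" "snd Bb"] that
    by (simp add: J_def RF_def case_prod_unfold)
  then have factor: "quot_fam sig ar Ob Aa = quot_fam sig ar Ob Bb"
    if "Aa \<in> RF" "Bb \<in> RF" "J Aa = J Bb" for Aa Bb using that by (metis subset_antisym)
  have "quot_fam sig ar Ob ` RF \<subseteq> (\<lambda>j. quot_fam sig ar Ob (SOME Aa. Aa \<in> RF \<and> J Aa = j)) ` J ` RF"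
  proof
    fix q assume "q \<in> quot_fam sig ar Ob ` RF"
    then obtain Aa where Aa: "Aa \<in> RF" "q = quot_fam sig ar Ob Aa" by blast
    have "(SOME Bb. Bb \<in> RF \<and> J Bb = J Aa) \<in> RF \<and> J (SOME Bb. Bb \<in> RF \<and> J Bb = J Aa) = J Aa"
      by (rule someI[of "\<lambda>Bb. Bb \<in> RF \<and> J Bb = J Aa" Aa]) (simp add: Aa)
    then have "q = quot_fam sig ar Ob (SOME Bb. Bb \<in> RF \<and> J Bb = J Aa)"
      unfolding Aa(2) by (intro factor[OF Aa(1)]) auto
    then show "q \<in> (\<lambda>j. quot_fam sig ar Ob (SOME Aa. Aa \<in> RF \<and> J Aa = j)) ` J ` RF"
      using Aa(1) by blast
  qed
  then show ?thesis unfolding regular_def RF_def[symmetric]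
    using fin by (meson finite_imageI finite_subset)
qed

section \<open>Branches of acyclic graphs\<close>

lemma rtranclp_simple_path:
  assumes "r\<^sup>*\<^sup>* a b"
  shows "\<exists>vs. vs \<noteq> [] \<and> hd vs = a \<and> last vs = b \<and> distinct vs \<and>
    (\<forall>i. Suc i < length vs \<longrightarrow> r (vs ! i) (vs ! Suc i))"
  using assms
proof (induction rule: converse_rtranclp_induct)
  case base
  show ?case by (rule exI[of _ "[b]"]) simp
next
  case (step a c)
  then obtain vs where vs: "vs \<noteq> []" "hd vs = c" "last vs = b" "distinct vs"
    "\<And>i. Suc i < length vs \<Longrightarrow> r (vs ! i) (vs ! Suc i)" by blast
  show ?case
  proof (cases "a \<in> set vs")
    case True
    then obtain k where k: "k < length vs" "vs ! k = a" by (auto simp: in_set_conv_nth)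
    show ?thesis
      by (rule exI[of _ "drop k vs"]) (use vs k in \<open>auto simp: hd_drop_conv_nth\<close>)
  next
    case False
    have "r ((a # vs) ! i) ((a # vs) ! Suc i)" if "Suc i < length (a # vs)" for i
      using that vs step(1) by (cases i) (auto simp: hd_conv_nth)
    then show ?thesis by (intro exI[of _ "a # vs"]) (use vs False in auto)
  qed
qed

locale acyclic_graph =
  fixes N :: "'a set" and E :: "'a \<Rightarrow> 'a \<Rightarrow> bool"
  assumes fin: "finite N" and edge: "E a b \<Longrightarrow> a \<in> N" and symE: "E a b \<Longrightarrow> E b a"
    and irr: "\<not> E a a" and acyclic: "\<not> has_cycle N E"
begin

definition minus_edge :: "'a \<Rightarrow> 'a \<Rightarrow> 'a \<Rightarrow> 'a \<Rightarrow> bool" where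
  "minus_edge p q a b \<longleftrightarrow> E a b \<and> {a, b} \<noteq> {p, q}"

lemma minus_edge_swap: "minus_edge p q = minus_edge q p"
  by (intro ext) (auto simp: minus_edge_def insert_commute)

text \<open>A simple path avoiding the edge would close up to a cycle. It has at least three nodes,
  since its ends differ and the only path with two nodes is the deleted edge.\<close>

lemma bridge:
  assumes pq: "E p q"
  shows "\<not> (minus_edge p q)\<^sup>*\<^sup>* p q"
proof
  assume "(minus_edge p q)\<^sup>*\<^sup>* p q"
  then obtain vs where vs: "vs \<noteq> []" "hd vs = p" "last vs = q" "distinct vs"
    "\<And>i. Suc i < length vs \<Longrightarrow> minus_edge p q (vs ! i) (vs ! Suc i)"
    using rtranclp_simple_path by metis
  have pnq: "p \<noteq> q" using pq irr by blast
  have "length vs \<noteq> 1" using vs(1-3) pnq by (cases vs) auto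
  moreover have "length vs \<noteq> 2"
  proof
    assume l: "length vs = 2"
    then have "vs ! 0 = p" "vs ! 1 = q" using vs(1-3) by (simp_all add: hd_conv_nth last_conv_nth)
    then show False using vs(5)[of 0] l by (simp add: minus_edge_def)
  qed
  moreover have "length vs \<noteq> 0" using vs(1) by simp
  ultimately have len: "length vs \<ge> 3" by linarith
  have "vs ! i \<in> N" if "i < length vs" for i
  proof (cases "Suc i < length vs")
    case True then show ?thesis using vs(5) edge by (auto simp: minus_edge_def)
  next
    case False
    then have "i = Suc (i - 1)" "Suc (i - 1) < length vs" using that len by auto
    then show ?thesis using vs(5)[of "i - 1"] edge symE by (auto simp: minus_edge_def)
  qed
  then have "set vs \<subseteq> N" by (auto simp: in_set_conv_nth)
  moreover have "E (last vs) (hd vs)" using vs symE[OF pq] by simp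
  ultimately have "has_cycle N E"
    unfolding has_cycle_def using len vs(4,5) by (auto simp: minus_edge_def)
  then show False using acyclic by simp
qed

text \<open>The component of \<open>q\<close> after deletion of the edge between \<open>p\<close>
  and \<open>q\<close>.\<close>

definition branch :: "'a \<Rightarrow> 'a \<Rightarrow> 'a set" where
  "branch p q = {w. (minus_edge p q)\<^sup>*\<^sup>* q w}"

lemma branch_disjoint:
  assumes pq: "E p q" and w: "w \<in> branch p q"
  shows "w \<notin> branch q p"
proof
  assume "w \<in> branch q p"
  then have 1: "(minus_edge p q)\<^sup>*\<^sup>* p w" by (simp add: branch_def minus_edge_swap)
  have "symp (minus_edge p q)"
    by (intro sympI) (use symE in \<open>auto simp: minus_edge_def insert_commute\<close>)
  then have "symp (minus_edge p q)\<^sup>*\<^sup>*" by (rule symp_rtranclp)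
  then have "(minus_edge p q)\<^sup>*\<^sup>* w q" using w by (auto simp: branch_def dest: sympD)
  then show False using 1 bridge[OF pq] by (meson rtranclp_trans)
qed

definition side :: "'a \<Rightarrow> 'a \<Rightarrow> 'a set \<Rightarrow> bool" where
  "side u v S \<longleftrightarrow> S \<subseteq> N \<and> v \<in> S \<and> u \<notin> S \<and> (\<forall>a b. E a b \<longrightarrow> a \<in> S \<longrightarrow> b \<notin> S \<longrightarrow> a = v \<and> b = u)"

lemma branch_side:
  assumes pq: "E p q"
  shows "side p q (branch p q)"
proof -
  have q: "q \<in> branch p q" by (simp add: branch_def)
  have p: "p \<notin> branch p q"
    using branch_disjoint[OF symE[OF pq], of p] by (auto simp: branch_def)
  have "a = q \<and> b = p" if ab: "E a b" "a \<in> branch p q" "b \<notin> branch p q" for a b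
  proof -
    have "\<not> minus_edge p q a b" using ab(2,3) unfolding branch_def by (metis mem_Collect_eq rtranclp.rtrancl_into_rtrancl)
    then have "{a, b} = {p, q}" using ab(1) by (simp add: minus_edge_def)
    then show ?thesis using p q ab(2,3) by (auto simp: doubleton_eq_iff)
  qed
  moreover have "w \<in> N" if "w \<in> branch p q" for w
  proof -
    have "(minus_edge p q)\<^sup>*\<^sup>* q w" using that by (simp add: branch_def)
    then show ?thesis
      by (induction rule: rtranclp_induct) (use edge symE pq in \<open>auto simp: minus_edge_def\<close>)
  qed
  ultimately show ?thesis using p q unfolding side_def by blast
qed

text \<open>A walk can leave \<open>S\<close> only by stepping to \<open>u\<close>, which the branch
  avoids.\<close>

lemma branch_subset_side:
  assumes S: "side u v S" and q: "q \<in> S" and u: "u \<notin> branch p q"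
  shows "branch p q \<subseteq> S"
proof
  fix w assume "w \<in> branch p q"
  then have "(minus_edge p q)\<^sup>*\<^sup>* q w" by (simp add: branch_def)
  then show "w \<in> S"
  proof (induction rule: rtranclp_induct)
    case base then show ?case by (rule q)
  next
    case (step y z)
    have "z \<in> branch p q" using step(1,2) by (simp add: branch_def)
    then have "z \<noteq> u" using u by blast
    then show ?case using step S unfolding side_def minus_edge_def by blast
  qed
qed

text \<open>Take a side of least size cut off by a marked edge. The two branches at a marked edge
  inside it would both have to contain \<open>u\<close>, since one avoiding \<open>u\<close> would
  be a smaller side; but they are disjoint.\<close>

lemma ex_side_without_marked_edges:
  assumes M: "M u0 v0" "\<And>u v. M u v \<Longrightarrow> E u v" "\<And>u v. M u v \<Longrightarrow> M v u"
  obtains u v S where "M u v" "side u v S" "\<And>a b. a \<in> S \<Longrightarrow> b \<in> S \<Longrightarrow> \<not> M a b"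
proof -
  define good where "good = (\<lambda>(u, v, S). M u v \<and> side u v S)"
  have "good (u0, v0, branch u0 v0)" using M branch_side by (simp add: good_def)
  from ex_has_least_nat[of good, OF this, of "\<lambda>(u, v, S). card S"]
  obtain t where t: "good t" "\<And>t'. good t' \<Longrightarrow> (case t of (u, v, S) \<Rightarrow> card S) \<le> (case t' of (u, v, S) \<Rightarrow> card S)"
    by blast
  obtain u v S where t_eq: "t = (u, v, S)" by (cases t)
  have uv: "M u v" and S: "side u v S" using t(1) by (simp_all add: t_eq good_def)
  have min: "card S \<le> card S'" if "M p q" "side p q S'" for p q S'
    using t(2)[of "(p, q, S')"] that by (simp add: t_eq good_def)
  have finS: "finite S" using S fin finite_subset unfolding side_def by blast
  have no: "u \<in> branch p q" if pq: "p \<in> S" "q \<in> S" "M p q" for p q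
  proof (rule ccontr)
    assume "u \<notin> branch p q"
    then have "branch p q \<subseteq> S" using branch_subset_side[OF S pq(2)] by blast
    moreover have b: "side p q (branch p q)" using branch_side M(2)[OF pq(3)] by blast
    ultimately have "branch p q \<subset> S" using pq(1) unfolding side_def by blast
    then have "card (branch p q) < card S" using finS by (rule psubset_card_mono[rotated])
    then show False using min[OF pq(3) b] by simp
  qed
  have "\<not> M a b" if ab: "a \<in> S" "b \<in> S" for a b
  proof
    assume m: "M a b"
    have "u \<in> branch a b" "u \<in> branch b a" using no ab m M(3) by blast+
    then show False using branch_disjoint[OF M(2)[OF m]] by blast
  qed
  then show ?thesis using that uv S by blast
qed

end

section \<open>Embeddings and incidence graphs of forests\<close>

lemma has_cycle_map:
  assumes "has_cycle N E" "inj_on \<phi> N" "\<phi> ` N \<subseteq> N'" "\<And>a b. E a b \<Longrightarrow> E' (\<phi> a) (\<phi> b)"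
  shows "has_cycle N' E'"
proof -
  obtain vs where vs: "length vs \<ge> 3" "distinct vs" "set vs \<subseteq> N"
    "\<forall>i. Suc i < length vs \<longrightarrow> E (vs ! i) (vs ! Suc i)" "E (last vs) (hd vs)"
    using assms(1) unfolding has_cycle_def by blast
  have ne: "vs \<noteq> []" using vs(1) by auto
  have "distinct (map \<phi> vs)"
    using vs(2) inj_on_subset[OF assms(2) vs(3)] by (simp add: distinct_map)
  moreover have "E' (last (map \<phi> vs)) (hd (map \<phi> vs))"
    using assms(4)[OF vs(5)] ne by (simp add: last_map hd_map)
  moreover have "set (map \<phi> vs) \<subseteq> N'" using vs(3) assms(3) by auto
  moreover have "\<forall>i. Suc i < length (map \<phi> vs) \<longrightarrow> E' (map \<phi> vs ! i) (map \<phi> vs ! Suc i)"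
    using vs(4) assms(4) by simp
  ultimately show ?thesis unfolding has_cycle_def using vs(1) by (intro exI[of _ "map \<phi> vs"]) simp
qed

lemma is_forest_embed:
  fixes sig :: "'r set"
  assumes C: "is_struc sig ar C" and f: "is_hom sig C T f" "inj_on f (verts C)"
    and T: "is_forest sig ar T"
  shows "is_forest sig ar C"
proof -
  have "distinct xs" if "R \<in> sig" "xs \<in> rels C R" for R xs
    using T is_homD(2)[OF f(1) that] that(1) unfolding is_forest_def by (metis distinct_map)
  moreover have "\<not> has_cycle (inc_nodes sig C) (inc_adj sig C)"
  proof
    assume cyc: "has_cycle (inc_nodes sig C) (inc_adj sig C)"
    define \<phi> where "\<phi> = map_sum f (\<lambda>(R :: 'r, xs). (R, map f xs))"
    have "inj_on \<phi> (inc_nodes sig C)"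
    proof (rule inj_onI)
      fix a b assume ab: "a \<in> inc_nodes sig C" "b \<in> inc_nodes sig C" "\<phi> a = \<phi> b"
      have eq: "xs = ys" if "xs \<in> rels C R" "ys \<in> rels C R" "map f xs = map f ys" for R xs ys
        using that(3) by (rule map_inj_on)
          (use that(1,2) is_strucD(4)[OF C] in \<open>auto intro: inj_on_subset[OF f(2)]\<close>)
      show "a = b"
        using ab eq inj_onD[OF f(2)] by (auto simp: \<phi>_def inc_nodes_def)
    qed
    moreover have "\<phi> ` inc_nodes sig C \<subseteq> inc_nodes sig T"
      using is_homD[OF f(1)] by (auto simp: \<phi>_def inc_nodes_def)
    moreover have "inc_adj sig T (\<phi> a) (\<phi> b)" if adj: "inc_adj sig C a b" for a b
    proof -
      obtain x R xs where R: "R \<in> sig" "xs \<in> rels C R" "x \<in> set xs"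
        and "a = Inl x \<and> b = Inr (R, xs) \<or> a = Inr (R, xs) \<and> b = Inl x"
        using adj unfolding inc_adj_def by blast
      moreover have "map f xs \<in> rels T R" "f x \<in> set (map f xs)"
        using is_homD(2)[OF f(1) R(1,2)] R(3) by auto
      ultimately show ?thesis unfolding inc_adj_def \<phi>_def by fastforce
    qed
    ultimately have "has_cycle (inc_nodes sig T) (inc_adj sig T)"
      using has_cycle_map[OF cyc] by blast
    then show False using T by (simp add: is_forest_def)
  qed
  ultimately show ?thesis using C by (simp add: is_forest_def)
qed

lemma in_fam_forest:
  assumes "is_struc sig ar C" "in_fam sig C Ob" "\<forall>T\<in>Ob. is_forest sig ar T"
  shows "is_forest sig ar C"
proof -
  obtain T i where T: "T \<in> Ob" and i: "bij_betw i (verts C) (verts T)"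
    and ir: "\<forall>R\<in>sig. rels T R = map i ` rels C R"
    using assms(2) unfolding in_fam_def is_iso_def by blast
  have "is_hom sig C T i" using bij_betwE[OF i] ir by (intro is_homI) auto
  then show ?thesis
    using is_forest_embed[OF assms(1) _ bij_betw_imp_inj_on[OF i]] assms(3) T by blast
qed

lemma finite_rels:
  assumes "is_struc sig ar A"
  shows "finite (rels A R)"
proof (rule finite_subset)
  show "rels A R \<subseteq> {xs. set xs \<subseteq> verts A \<and> length xs = ar R}"
    using is_strucD[OF assms] by blast
  show "finite {xs. set xs \<subseteq> verts A \<and> length xs = ar R}"
    by (rule finite_lists_length_eq) (rule is_strucD(1)[OF assms])
qed

lemma forest_acyclic_graph:
  assumes sig: "finite sig" and C: "is_forest sig ar C"
  shows "acyclic_graph (inc_nodes sig C) (inc_adj sig C)"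
proof
  have st: "is_struc sig ar C" using C by (simp add: is_forest_def)
  have "{(R, xs). R \<in> sig \<and> xs \<in> rels C R} = Sigma sig (rels C)" by auto
  then show "finite (inc_nodes sig C)"
    using sig finite_rels[OF st] is_strucD(1)[OF st] by (simp add: inc_nodes_def)
  show "a \<in> inc_nodes sig C" if "inc_adj sig C a b" for a b
    using that is_strucD(4)[OF st] unfolding inc_adj_def inc_nodes_def by blast
  show "inc_adj sig C b a" if "inc_adj sig C a b" for a b
    using that unfolding inc_adj_def by blast
  show "\<not> inc_adj sig C a a" for a unfolding inc_adj_def by blast
  show "\<not> has_cycle (inc_nodes sig C) (inc_adj sig C)" using C by (simp add: is_forest_def)
qed

section \<open>Duals of regular families\<close>

definition forest_type :: "'r set \<Rightarrow> ('r \<Rightarrow> nat) \<Rightarrow> 'r struc set \<Rightarrow> 'r struc \<Rightarrow> nat \<Rightarrow> ('r struc \<times> nat) set set" where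
  "forest_type sig ar Ob A x =
     {quot_fam sig ar Ob (T, t) | T t. is_rooted_forest sig ar (T, t) \<and> (\<exists>f. is_hom sig T A f \<and> f t = x)}"

text \<open>A map to the colour image of \<open>A\<close>, lifted to \<open>A\<close> separately on the vertices (by \<open>\<kappa>\<close>) and on the blocks (by \<open>l\<close>).\<close>

definition partial_lift :: "'r set \<Rightarrow> ('r \<Rightarrow> nat) \<Rightarrow> 'r struc set \<Rightarrow> 'r struc \<Rightarrow> 'r struc \<Rightarrow>
    (nat \<Rightarrow> nat) \<Rightarrow> ('r \<Rightarrow> nat list \<Rightarrow> nat list) \<Rightarrow> bool" where
  "partial_lift sig ar Ob A C \<kappa> l \<longleftrightarrow> is_struc sig ar C \<and> in_fam sig C Ob \<and>
     (\<forall>v\<in>verts C. \<kappa> v \<in> verts A) \<and>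
     (\<forall>R\<in>sig. \<forall>xs\<in>rels C R. l R xs \<in> rels A R \<and>
        map (forest_type sig ar Ob A) (l R xs) = map (forest_type sig ar Ob A) (map \<kappa> xs))"

text \<open>Conflicts are recorded by vertex and block, so that they are edges of the incidence
  graph. In a forest the vertex determines its position in the tuple.\<close>

definition conflicts :: "'r set \<Rightarrow> 'r struc \<Rightarrow> (nat \<Rightarrow> nat) \<Rightarrow> ('r \<Rightarrow> nat list \<Rightarrow> nat list) \<Rightarrow>
    (nat \<times> 'r \<times> nat list) set" where
  "conflicts sig C \<kappa> l = {(xs ! i, R, xs) | R xs i. R \<in> sig \<and> xs \<in> rels C R \<and> i < length xs \<and>
     l R xs ! i \<noteq> \<kappa> (xs ! i)}"

lemma finite_conflicts:
  assumes "finite sig" "is_struc sig ar C"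
  shows "finite (conflicts sig C \<kappa> l)"
proof (rule finite_subset)
  show "conflicts sig C \<kappa> l \<subseteq> verts C \<times> Sigma sig (rels C)"
    using is_strucD(4)[OF assms(2)] by (fastforce simp: conflicts_def)
  show "finite (verts C \<times> Sigma sig (rels C))"
    using assms finite_rels[OF assms(2)] is_strucD(1)[OF assms(2)] by blast
qed

lemma is_struc_glue:
  assumes A: "is_struc sig ar A" and B: "is_struc sig ar B" and glue: "is_glue sig C (A, a) (B, b)"
  shows "is_struc sig ar C"
proof -
  from glue obtain f g where vC: "f ` verts A \<union> g ` verts B = verts C"
    and rC: "\<forall>R\<in>sig. rels C R = map f ` rels A R \<union> map g ` rels B R"
    "\<forall>R. R \<notin> sig \<longrightarrow> rels C R = {}"
    unfolding is_glue_def by auto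
  show ?thesis
  proof (rule is_strucI)
    show "finite (verts C)" using is_strucD(1)[OF A] is_strucD(1)[OF B] by (simp flip: vC)
    fix R xs assume xs: "xs \<in> rels C R"
    then have R: "R \<in> sig" using rC(2) by blast
    then consider ys where "ys \<in> rels A R" "xs = map f ys" | ys where "ys \<in> rels B R" "xs = map g ys"
      using xs rC(1) by blast
    then show "R \<in> sig \<and> length xs = ar R \<and> set xs \<subseteq> verts C"
      using R is_strucD(3,4)[OF A] is_strucD(3,4)[OF B] by cases (auto simp flip: vC)
  qed
qed

text \<open>The class of \<open>(K, x)\<close> belongs to the type of \<open>\<mu> x\<close>, hence
  to that of \<open>z\<close>, so an equivalent forest \<open>(K', k)\<close> maps to
  \<open>A\<close> with root value \<open>z\<close>. Gluing it to \<open>M\<close> stays in the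
  family, and as \<open>K'\<close> carries a homomorphism, all conflicts left come from
  \<open>M\<close>.\<close>

lemma replace_part:
  assumes sig: "finite sig" and forests: "\<forall>T\<in>Ob. is_forest sig ar T"
    and pl: "partial_lift sig ar Ob A C \<kappa> l"
    and K: "is_struc sig ar K" and M: "is_struc sig ar M"
    and KM: "verts K \<union> verts M = verts C" "verts K \<inter> verts M = {x}" "\<And>R. rels K R \<union> rels M R = rels C R"
    and \<mu>: "is_hom sig K A \<mu>" and z: "z \<in> verts A"
    and type: "forest_type sig ar Ob A z = forest_type sig ar Ob A (\<mu> x)"
      "forest_type sig ar Ob A z = forest_type sig ar Ob A (\<kappa> x)"
  obtains C' \<kappa>' l' where "partial_lift sig ar Ob A C' \<kappa>' l'"
    "card (conflicts sig C' \<kappa>' l') \<le> card (conflicts sig M (\<kappa>(x := z)) l)"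
proof -
  let ?\<psi> = "forest_type sig ar Ob A"
  have C: "is_struc sig ar C" "in_fam sig C Ob" and \<kappa>: "\<And>v. v \<in> verts C \<Longrightarrow> \<kappa> v \<in> verts A"
    and l: "\<And>R xs. R \<in> sig \<Longrightarrow> xs \<in> rels C R \<Longrightarrow> l R xs \<in> rels A R"
      "\<And>R xs. R \<in> sig \<Longrightarrow> xs \<in> rels C R \<Longrightarrow> map ?\<psi> (l R xs) = map ?\<psi> (map \<kappa> xs)"
    using pl unfolding partial_lift_def by blast+
  have x: "x \<in> verts K" "x \<in> verts M" using KM(2) by auto
  have forC: "is_forest sig ar C" by (rule in_fam_forest[OF C forests])
  have "is_hom sig K C id" "is_hom sig M C id"
    by (auto intro!: is_homI simp flip: KM(1,3))
  then have rfK: "is_rooted_forest sig ar (K, x)" and rfM: "is_rooted_forest sig ar (M, x)"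
    using is_forest_embed[OF K _ _ forC] is_forest_embed[OF M _ _ forC] x
    by (auto simp: is_rooted_forest_def)
  have "quot_fam sig ar Ob (K, x) \<in> ?\<psi> (\<mu> x)"
    unfolding forest_type_def using rfK \<mu> by blast
  then have "quot_fam sig ar Ob (K, x) \<in> ?\<psi> z" using type(1) by simp
  then obtain K' k \<nu> where q: "quot_fam sig ar Ob (K, x) = quot_fam sig ar Ob (K', k)"
    and rfK': "is_rooted_forest sig ar (K', k)" and \<nu>: "is_hom sig K' A \<nu>" "\<nu> k = z"
    unfolding forest_type_def by blast
  have K': "is_struc sig ar K'" "k \<in> verts K'"
    using rfK' by (auto simp: is_rooted_forest_def is_forest_def)
  have "is_glue sig C (K, x) (M, x)"
    unfolding is_glue_def prod.case
    by (rule exI[of _ id], rule exI[of _ id]) (use KM is_strucD(2)[OF C(1)] in auto)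
  then have "(M, x) \<in> quot_fam sig ar Ob (K, x)"
    unfolding quot_fam_def using rfM C(2) by blast
  then have "(M, x) \<in> quot_fam sig ar Ob (K', k)" using q by simp
  then obtain C' where glue: "is_glue sig C' (K', k) (M, x)" and fam: "in_fam sig C' Ob"
    unfolding quot_fam_def by blast
  have C': "is_struc sig ar C'" by (rule is_struc_glue[OF K'(1) M glue])
  from glue obtain f g where f: "inj_on f (verts K')" and g: "inj_on g (verts M)" and fg: "f k = g x"
    and vC': "f ` verts K' \<union> g ` verts M = verts C'" "f ` verts K' \<inter> g ` verts M = {f k}"
    and rC': "\<forall>R\<in>sig. rels C' R = map f ` rels K' R \<union> map g ` rels M R"
    unfolding is_glue_def by auto
  let ?\<kappa>1 = "\<kappa>(x := z)"
  define \<kappa>' where "\<kappa>' w = (if w \<in> f ` verts K' then \<nu> (inv_into (verts K') f w)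
      else ?\<kappa>1 (inv_into (verts M) g w))" for w
  \<comment> \<open>A tuple at the root may come from both \<open>K'\<close> and \<open>M\<close>;
    giving priority to \<open>K'\<close> keeps it free of conflicts.\<close>
  define l' where "l' R ys = (if ys \<in> map f ` rels K' R then map \<kappa>' ys
      else l R (map (inv_into (verts M) g) ys))" for R ys
  have \<kappa>'f: "\<kappa>' (f v) = \<nu> v" if "v \<in> verts K'" for v
    using that f by (simp add: \<kappa>'_def)
  have \<kappa>'g: "\<kappa>' (g v) = ?\<kappa>1 v" if v: "v \<in> verts M" for v
  proof (cases "g v \<in> f ` verts K'")
    case True
    then have "g v = g x" using vC'(2) v fg by auto
    then have "v = x" using g v x(2) by (auto dest: inj_onD)
    then show ?thesis using \<kappa>'f[OF K'(2)] fg \<nu>(2) by simp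
  next
    case False
    then show ?thesis using g v by (simp add: \<kappa>'_def)
  qed
  have map\<kappa>'f: "map \<kappa>' (map f ys) = map \<nu> ys" if "ys \<in> rels K' R" for ys R
    using \<kappa>'f is_strucD(4)[OF K'(1) that] by simp
  have map\<kappa>'g: "map \<kappa>' (map g ys) = map ?\<kappa>1 ys" if "ys \<in> rels M R" for ys R
    using \<kappa>'g is_strucD(4)[OF M that] by simp
  have l'g: "l' R (map g ys) = l R ys" if "ys \<in> rels M R" "map g ys \<notin> map f ` rels K' R" for R ys
  proof -
    have "map (inv_into (verts M) g) (map g ys) = ys"
      using g is_strucD(4)[OF M that(1)] by (simp add: map_idI)
    then show ?thesis using that(2) by (simp add: l'_def)
  qed
  have \<psi>1: "?\<psi> (?\<kappa>1 v) = ?\<psi> (\<kappa> v)" for v using type(2) by simp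
  have "partial_lift sig ar Ob A C' \<kappa>' l'"
    unfolding partial_lift_def
  proof (intro conjI ballI C' fam)
    fix w assume "w \<in> verts C'"
    then consider v where "v \<in> verts K'" "w = f v" | v where "v \<in> verts M" "w = g v"
      unfolding vC'(1)[symmetric] by blast
    then show "\<kappa>' w \<in> verts A"
    proof cases
      case 1 then show ?thesis using \<kappa>'f is_homD(1)[OF \<nu>(1)] by simp
    next
      case 2
      then have "\<kappa> v \<in> verts A" using \<kappa> KM(1) by blast
      then show ?thesis using 2 \<kappa>'g z by simp
    qed
  next
    fix R ys assume R: "R \<in> sig" and ys: "ys \<in> rels C' R"
    have "l' R ys \<in> rels A R \<and> map ?\<psi> (l' R ys) = map ?\<psi> (map \<kappa>' ys)"
    proof (cases "ys \<in> map f ` rels K' R")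
      case True
      then obtain ks where ks: "ks \<in> rels K' R" "ys = map f ks" by blast
      have "l' R ys = map \<kappa>' ys" using True by (simp add: l'_def)
      moreover have "map \<kappa>' ys \<in> rels A R"
        unfolding ks(2) map\<kappa>'f[OF ks(1)] by (rule is_homD(2)[OF \<nu>(1) R ks(1)])
      ultimately show ?thesis by simp
    next
      case False
      then obtain ms where ms: "ms \<in> rels M R" "ys = map g ms" using ys rC' R by blast
      have l'ys: "l' R ys = l R ms" using l'g[OF ms(1)] False ms(2) by simp
      have msC: "ms \<in> rels C R" using ms(1) KM(3) by blast
      have "map ?\<psi> (map \<kappa>' ys) = map ?\<psi> (map \<kappa> ms)"
        unfolding ms(2) map\<kappa>'g[OF ms(1)] using \<psi>1 by simp
      then show ?thesis unfolding l'ys using l[OF R msC] by simp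
    qed
    then show "l' R ys \<in> rels A R" "map ?\<psi> (l' R ys) = map ?\<psi> (map \<kappa>' ys)" by simp_all
  qed
  moreover
  have "conflicts sig C' \<kappa>' l' \<subseteq> (\<lambda>(v, R, ms). (g v, R, map g ms)) ` conflicts sig M ?\<kappa>1 l"
  proof
    fix c assume "c \<in> conflicts sig C' \<kappa>' l'"
    then obtain R ys i where c: "c = (ys ! i, R, ys)" and R: "R \<in> sig" "ys \<in> rels C' R"
      and i: "i < length ys" "l' R ys ! i \<noteq> \<kappa>' (ys ! i)"
      unfolding conflicts_def by blast
    have nf: "ys \<notin> map f ` rels K' R" using i by (auto simp: l'_def)
    then obtain ms where ms: "ms \<in> rels M R" "ys = map g ms" using R rC' by blast
    have "l R ms ! i \<noteq> ?\<kappa>1 (ms ! i)"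
    proof -
      have im: "i < length ms" using i(1) ms(2) by simp
      then have "\<kappa>' (ys ! i) = ?\<kappa>1 (ms ! i)"
        using \<kappa>'g is_strucD(4)[OF M ms(1)] ms(2) by simp
      moreover have "l' R ys = l R ms" using l'g[OF ms(1)] nf ms(2) by simp
      ultimately show ?thesis using i(2) by simp
    qed
    then have "(ms ! i, R, ms) \<in> conflicts sig M ?\<kappa>1 l"
      unfolding conflicts_def using R(1) ms i(1) by (auto simp del: fun_upd_apply)
    moreover have "c = (\<lambda>(v, R, ms). (g v, R, map g ms)) (ms ! i, R, ms)"
      using c ms(2) i(1) by simp
    ultimately show "c \<in> (\<lambda>(v, R, ms). (g v, R, map g ms)) ` conflicts sig M ?\<kappa>1 l" by blast
  qed
  then have "card (conflicts sig C' \<kappa>' l') \<le> card (conflicts sig M ?\<kappa>1 l)"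
    using finite_conflicts[OF sig M] by (rule surj_card_le[rotated])
  ultimately show ?thesis using that by blast
qed

text \<open>Among the sides of conflicting incidences choose a minimal one. It contains no further conflict, so it maps to \<open>A\<close>
  and can be replaced by an equivalent rooted forest that takes the value demanded on the other side.\<close>

lemma partial_lift_improve:
  assumes sig: "finite sig" and A: "is_struc sig ar A" and forests: "\<forall>T\<in>Ob. is_forest sig ar T"
    and pl: "partial_lift sig ar Ob A C \<kappa> l" and conf: "conflicts sig C \<kappa> l \<noteq> {}"
  obtains C' \<kappa>' l' where "partial_lift sig ar Ob A C' \<kappa>' l'"
    "card (conflicts sig C' \<kappa>' l') < card (conflicts sig C \<kappa> l)"
proof -
  let ?\<psi> = "forest_type sig ar Ob A"
  have C: "is_struc sig ar C" "in_fam sig C Ob" and \<kappa>: "\<And>v. v \<in> verts C \<Longrightarrow> \<kappa> v \<in> verts A"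
    and l: "\<And>R xs. R \<in> sig \<Longrightarrow> xs \<in> rels C R \<Longrightarrow> l R xs \<in> rels A R"
      "\<And>R xs. R \<in> sig \<Longrightarrow> xs \<in> rels C R \<Longrightarrow> map ?\<psi> (l R xs) = map ?\<psi> (map \<kappa> xs)"
    using pl unfolding partial_lift_def by blast+
  have len: "length (l R xs) = length xs" if "R \<in> sig" "xs \<in> rels C R" for R xs
    using is_strucD(3)[OF A l(1)[OF that]] is_strucD(3)[OF C(1) that(2)] by simp
  have forC: "is_forest sig ar C" by (rule in_fam_forest[OF C forests])
  have distinct: "distinct xs" if "R \<in> sig" "xs \<in> rels C R" for R xs
    using forC that unfolding is_forest_def by blast
  interpret acyclic_graph "inc_nodes sig C" "inc_adj sig C"
    by (rule forest_acyclic_graph[OF sig forC])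
  define Mk where "Mk u v \<longleftrightarrow> (\<exists>x R xs. (x, R, xs) \<in> conflicts sig C \<kappa> l \<and>
    (u = Inl x \<and> v = Inr (R, xs) \<or> u = Inr (R, xs) \<and> v = Inl x))" for u v
  obtain x1 R1 xs1 where "(x1, R1, xs1) \<in> conflicts sig C \<kappa> l" using conf by auto
  then have ex: "Mk (Inl x1) (Inr (R1, xs1))" unfolding Mk_def by blast
  have Mk_adj: "inc_adj sig C u v" if mk: "Mk u v" for u v
  proof -
    obtain x R xs where c: "(x, R, xs) \<in> conflicts sig C \<kappa> l"
      and uv: "u = Inl x \<and> v = Inr (R, xs) \<or> u = Inr (R, xs) \<and> v = Inl x"
      using mk unfolding Mk_def by blast
    have "R \<in> sig" "xs \<in> rels C R" "x \<in> set xs" using c by (auto simp: conflicts_def)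
    then show ?thesis using uv unfolding inc_adj_def by blast
  qed
  have Mk_sym: "Mk v u" if "Mk u v" for u v using that unfolding Mk_def by blast
  obtain u v S where uv: "Mk u v" and S: "side u v S"
    and clean: "\<And>a b. a \<in> S \<Longrightarrow> b \<in> S \<Longrightarrow> \<not> Mk a b"
    using ex_side_without_marked_edges[of Mk, OF ex Mk_adj Mk_sym] by blast
  obtain x R0 xs0 where c0: "(x, R0, xs0) \<in> conflicts sig C \<kappa> l"
    and uv_cases: "u = Inl x \<and> v = Inr (R0, xs0) \<or> u = Inr (R0, xs0) \<and> v = Inl x"
    using uv unfolding Mk_def by blast
  obtain i where R0: "R0 \<in> sig" "xs0 \<in> rels C R0" and i: "i < length xs0" "xs0 ! i = x"
    "l R0 xs0 ! i \<noteq> \<kappa> x"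
    using c0 unfolding conflicts_def by blast
  have xC: "x \<in> verts C" using is_strucD(4)[OF C(1) R0(2)] i by auto
  have i_unique: "j = i" if "j < length xs0" "xs0 ! j = x" for j
    using nth_eq_iff_index_eq[OF distinct[OF R0] that(1) i(1)] that(2) i(2) by simp
  define y where "y = l R0 xs0 ! i"
  have yA: "y \<in> verts A"
    using is_strucD(4)[OF A l(1)[OF R0]] len[OF R0] i(1) by (simp add: y_def)
  have y\<psi>: "?\<psi> y = ?\<psi> (\<kappa> x)"
    using arg_cong[OF l(2)[OF R0], of "\<lambda>zs. zs ! i"] len[OF R0] i by (simp add: y_def)
  have cross: "a = v \<and> b = u" if "inc_adj sig C a b" "a \<in> S" "b \<notin> S" for a b
    using S that unfolding side_def by blast
  have vS: "v \<in> S" and uS: "u \<notin> S" using S by (simp_all add: side_def)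
  have adj: "inc_adj sig C (Inl w) (Inr (R, xs))" "inc_adj sig C (Inr (R, xs)) (Inl w)"
    if "R \<in> sig" "xs \<in> rels C R" "w \<in> set xs" for w R xs
    using that unfolding inc_adj_def by blast+
  have no_conflict: "l R xs ! j = \<kappa> (xs ! j)"
    if c: "R \<in> sig" "xs \<in> rels C R" "j < length xs" "Inr (R, xs) \<in> S" "Inl (xs ! j) \<in> S" for R xs j
  proof (rule ccontr)
    assume "l R xs ! j \<noteq> \<kappa> (xs ! j)"
    then have "(xs ! j, R, xs) \<in> conflicts sig C \<kappa> l" unfolding conflicts_def using c by blast
    then have "Mk (Inl (xs ! j)) (Inr (R, xs))" unfolding Mk_def by blast
    then show False using clean c(4,5) by blast
  qed
  \<comment> \<open>The cut runs between \<open>x\<close> and the block \<open>(R0, xs0)\<close>.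
    The vertex \<open>x\<close> goes into both parts as their common root, whichever end lies in
    \<open>S\<close>; the block goes into one part only.\<close>
  define K where "K = \<lparr>verts = insert x {w \<in> verts C. Inl w \<in> S}, rels = (\<lambda>R. {xs \<in> rels C R. Inr (R, xs) \<in> S})\<rparr>"
  define M where "M = \<lparr>verts = insert x {w \<in> verts C. Inl w \<notin> S}, rels = (\<lambda>R. {xs \<in> rels C R. Inr (R, xs) \<notin> S})\<rparr>"
  have vK: "w = x \<or> Inl w \<in> S" if "xs \<in> rels C R" "Inr (R, xs) \<in> S" "w \<in> set xs" for w R xs
    using cross[OF adj(2)[OF is_strucD(2)[OF C(1) that(1)] that(1,3)] that(2)] uv_cases by blast
  have vM: "w = x \<or> Inl w \<notin> S" if "xs \<in> rels C R" "Inr (R, xs) \<notin> S" "w \<in> set xs" for w R xs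
    using cross[OF adj(1)[OF is_strucD(2)[OF C(1) that(1)] that(1,3)] _ that(2)] uv_cases by blast
  have sK: "is_struc sig ar K"
  proof (rule is_strucI)
    show "finite (verts K)" using is_strucD(1)[OF C(1)] by (simp add: K_def)
    fix R xs assume "xs \<in> rels K R"
    then have xs: "xs \<in> rels C R" "Inr (R, xs) \<in> S" by (simp_all add: K_def)
    show "R \<in> sig \<and> length xs = ar R \<and> set xs \<subseteq> verts K"
      using is_strucD(2-4)[OF C(1) xs(1)] vK[OF xs] by (auto simp: K_def)
  qed
  have sM: "is_struc sig ar M"
  proof (rule is_strucI)
    show "finite (verts M)" using is_strucD(1)[OF C(1)] by (simp add: M_def)
    fix R xs assume "xs \<in> rels M R"
    then have xs: "xs \<in> rels C R" "Inr (R, xs) \<notin> S" by (simp_all add: M_def)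
    show "R \<in> sig \<and> length xs = ar R \<and> set xs \<subseteq> verts M"
      using is_strucD(2-4)[OF C(1) xs(1)] vM[OF xs] by (auto simp: M_def)
  qed
  have KM: "verts K \<union> verts M = verts C" "verts K \<inter> verts M = {x}" "\<And>R. rels K R \<union> rels M R = rels C R"
    using xC by (auto simp: K_def M_def)
  \<comment> \<open>The end of the edge from \<open>x\<close> to the block that lies in \<open>S\<close> determines the value at \<open>x\<close> on the clean side.\<close>
  define p where "p = (if Inl x \<in> S then \<kappa> x else y)"
  define z where "z = (if Inl x \<in> S then y else \<kappa> x)"
  have \<mu>: "is_hom sig K A (\<kappa>(x := p))"
  proof (rule is_homI)
    show "(\<kappa>(x := p)) w \<in> verts A" if "w \<in> verts K" for w
      using that \<kappa> yA xC by (auto simp: K_def p_def)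
    fix R xs assume R: "R \<in> sig" and "xs \<in> rels K R"
    then have xs: "xs \<in> rels C R" "Inr (R, xs) \<in> S" by (simp_all add: K_def)
    have "map (\<kappa>(x := p)) xs = l R xs"
    proof (rule nth_equalityI)
      show "length (map (\<kappa>(x := p)) xs) = length (l R xs)" using len[OF R xs(1)] by simp
      fix j assume "j < length (map (\<kappa>(x := p)) xs)"
      then have j: "j < length xs" by simp
      have "(\<kappa>(x := p)) (xs ! j) = l R xs ! j"
      proof (cases "Inl (xs ! j) \<in> S")
        case True
        then show ?thesis using no_conflict[OF R xs(1) j xs(2) True] by (auto simp: p_def)
      next
        case False
        have "xs ! j = x" using vK[OF xs nth_mem[OF j]] False by blast
        moreover have "Inr (R, xs) = v"
          using cross[OF adj(2)[OF R xs(1) nth_mem[OF j]] xs(2) False] by blast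
        then have "R = R0" "xs = xs0" using uv_cases by auto
        ultimately show ?thesis using False i_unique j by (auto simp: p_def y_def)
      qed
      then show "map (\<kappa>(x := p)) xs ! j = l R xs ! j" using j by simp
    qed
    then show "map (\<kappa>(x := p)) xs \<in> rels A R" using l(1)[OF R xs(1)] by simp
  qed
  \<comment> \<open>If \<open>x\<close> lies in \<open>S\<close>, the only block of \<open>M\<close>
    through \<open>x\<close> is \<open>(R0, xs0)\<close>, and \<open>z\<close> is the value it
    demands. Otherwise that block has gone into \<open>K\<close> and the value at \<open>x\<close>
    is unchanged. The chosen conflict disappears either way and none arises.\<close>
  have sub: "conflicts sig M (\<kappa>(x := z)) l \<subseteq> conflicts sig C \<kappa> l - {(x, R0, xs0)}"
  proof
    fix c assume "c \<in> conflicts sig M (\<kappa>(x := z)) l"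
    then obtain R xs j where c: "c = (xs ! j, R, xs)" and R: "R \<in> sig" and "xs \<in> rels M R"
      and j: "j < length xs" "l R xs ! j \<noteq> (\<kappa>(x := z)) (xs ! j)"
      unfolding conflicts_def by blast
    then have xs: "xs \<in> rels C R" "Inr (R, xs) \<notin> S" by (simp_all add: M_def)
    show "c \<in> conflicts sig C \<kappa> l - {(x, R0, xs0)}"
    proof (cases "Inl x \<in> S")
      case True
      have "xs ! j \<noteq> x"
      proof
        assume jx: "xs ! j = x"
        have "Inr (R, xs) = u"
          using cross[OF adj(1)[OF R xs(1) nth_mem[OF j(1)]] _ xs(2)] True jx by simp
        then have "R = R0" "xs = xs0" using uv_cases by auto
        then show False using j jx i_unique True by (auto simp: z_def y_def)
      qed
      then show ?thesis unfolding conflicts_def c using R xs(1) j by auto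
    next
      case False
      then have "Inr (R0, xs0) \<in> S" using vS uv_cases by auto
      then have "(R, xs) \<noteq> (R0, xs0)" using xs(2) by auto
      moreover have "l R xs ! j \<noteq> \<kappa> (xs ! j)" using j(2) False by (auto simp: z_def split: if_splits)
      ultimately show ?thesis unfolding conflicts_def c using R xs(1) j(1) by auto
    qed
  qed
  obtain C' \<kappa>' l' where C': "partial_lift sig ar Ob A C' \<kappa>' l'"
    "card (conflicts sig C' \<kappa>' l') \<le> card (conflicts sig M (\<kappa>(x := z)) l)"
  proof (rule replace_part[OF sig forests pl sK sM KM \<mu>, of z])
    show "z \<in> verts A" using yA \<kappa>[OF xC] by (simp add: z_def)
    show "?\<psi> z = ?\<psi> ((\<kappa>(x := p)) x)" "?\<psi> z = ?\<psi> (\<kappa> x)" using y\<psi> by (simp_all add: z_def p_def)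
  qed blast
  have "card (conflicts sig M (\<kappa>(x := z)) l) \<le> card (conflicts sig C \<kappa> l - {(x, R0, xs0)})"
    using sub finite_conflicts[OF sig C(1)] by (intro card_mono) auto
  also have "\<dots> < card (conflicts sig C \<kappa> l)"
    using c0 finite_conflicts[OF sig C(1)] by (rule card_Diff1_less[rotated])
  finally show ?thesis using that C' by simp
qed

lemma partial_lift_imp_hom:
  assumes sig: "finite sig" and A: "is_struc sig ar A" and forests: "\<forall>T\<in>Ob. is_forest sig ar T"
    and "partial_lift sig ar Ob A C \<kappa> l"
  shows "\<exists>T\<in>Ob. hom_to sig T A"
  using assms(4)
proof (induction "card (conflicts sig C \<kappa> l)" arbitrary: C \<kappa> l rule: less_induct)
  case less
  show ?case
  proof (cases "conflicts sig C \<kappa> l = {}")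
    case False
    from partial_lift_improve[OF sig A forests less.prems this] show ?thesis
      using less.hyps by metis
  next
    case True
    have C: "is_struc sig ar C" "in_fam sig C Ob" and \<kappa>: "\<And>v. v \<in> verts C \<Longrightarrow> \<kappa> v \<in> verts A"
      and l: "\<And>R xs. R \<in> sig \<Longrightarrow> xs \<in> rels C R \<Longrightarrow> l R xs \<in> rels A R"
      using less.prems unfolding partial_lift_def by blast+
    have "is_hom sig C A \<kappa>"
    proof (rule is_homI)
      fix R xs assume R: "R \<in> sig" "xs \<in> rels C R"
      have "map \<kappa> xs = l R xs"
      proof (rule nth_equalityI)
        show "length (map \<kappa> xs) = length (l R xs)"
          using is_strucD(3)[OF A l[OF R]] is_strucD(3)[OF C(1) R(2)] by simp
        show "map \<kappa> xs ! j = l R xs ! j" if "j < length (map \<kappa> xs)" for j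
          using True R that unfolding conflicts_def by auto
      qed
      then show "map \<kappa> xs \<in> rels A R" using l[OF R] by simp
    qed (rule \<kappa>)
    then have "hom_to sig C A" unfolding hom_to_def by blast
    then show ?thesis using in_fam_hom[OF C] hom_to_trans by metis
  qed
qed

lemma finite_strucs_over:
  assumes "finite sig" "finite V"
  shows "finite {S. is_struc sig ar S \<and> verts S \<subseteq> V}"
proof -
  define L where "L = (\<Union>R\<in>sig. {xs. set xs \<subseteq> V \<and> length xs = ar R})"
  have "finite L" unfolding L_def using assms finite_lists_length_eq by blast
  then have fin: "finite (Pow V \<times> {r. \<forall>R. (R \<in> sig \<longrightarrow> r R \<in> Pow L) \<and> (R \<notin> sig \<longrightarrow> r R = {})})"
    using assms by (intro finite_cartesian_product finite_set_of_finite_funs) auto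
  have "(\<lambda>S. (verts S, rels S)) ` {S. is_struc sig ar S \<and> verts S \<subseteq> V} \<subseteq>
      Pow V \<times> {r. \<forall>R. (R \<in> sig \<longrightarrow> r R \<in> Pow L) \<and> (R \<notin> sig \<longrightarrow> r R = {})}"
    unfolding L_def is_struc_def by fastforce
  then have "finite ((\<lambda>S. (verts S, rels S)) ` {S. is_struc sig ar S \<and> verts S \<subseteq> V})"
    using fin by (rule finite_subset)
  moreover have "inj_on (\<lambda>S. (verts S, rels S)) {S. is_struc sig ar S \<and> verts S \<subseteq> V}"
    by (rule inj_onI) simp
  ultimately show ?thesis by (rule finite_imageD)
qed

lemma regular_imp_duality:
  assumes sig: "finite sig" and forests: "\<forall>T\<in>Ob. is_forest sig ar T" and reg: "regular sig ar Ob"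
  obtains Ds where "finite Ds" "\<forall>D\<in>Ds. is_struc sig ar D" "duality_pair sig ar Ob Ds"
proof -
  define Q where "Q = quot_fam sig ar Ob ` {Aa. is_rooted_forest sig ar Aa}"
  have "finite (Pow Q)" using reg by (simp add: Q_def regular_def)
  \<comment> \<open>Colours are sets of classes, while vertices are numbers, so the colours are
    coded by \<open>c\<close>. All colour images then live on one finite vertex set, which leaves
    finitely many of them.\<close>
  from finite_imp_inj_to_nat_seg[OF this] obtain c :: "_ \<Rightarrow> nat" where c: "inj_on c (Pow Q)" by blast
  have typeQ: "forest_type sig ar Ob A x \<in> Pow Q" for A x
    unfolding forest_type_def Q_def by blast
  define h where "h A = c \<circ> forest_type sig ar Ob A" for A
  define Ds where "Ds = {image_struc (h A) A | A. is_struc sig ar A \<and> \<not> (\<exists>T\<in>Ob. hom_to sig T A)}"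
  have strDs: "is_struc sig ar D" if "D \<in> Ds" for D
    using that is_struc_image unfolding Ds_def by blast
  have "Ds \<subseteq> {S. is_struc sig ar S \<and> verts S \<subseteq> c ` Pow Q}"
    using strDs typeQ by (auto simp: Ds_def h_def)
  then have finDs: "finite Ds"
    by (rule finite_subset) (rule finite_strucs_over[OF sig finite_imageI[OF \<open>finite (Pow Q)\<close>]])
  have key: "\<exists>T\<in>Ob. hom_to sig T A"
    if A: "is_struc sig ar A" and T: "T \<in> Ob" and f: "is_hom sig T (image_struc (h A) A) f" for A T f
  proof -
    let ?\<psi> = "forest_type sig ar Ob A"
    have sT: "is_struc sig ar T" using forests T by (simp add: is_forest_def)
    have same: "?\<psi> a = ?\<psi> b" if "h A a = h A b" for a b
      using inj_onD[OF c] that typeQ unfolding h_def by (metis comp_apply)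
    have "\<forall>v\<in>verts T. \<exists>a. a \<in> verts A \<and> h A a = f v"
      using is_homD(1)[OF f] by force
    then obtain \<kappa> where \<kappa>: "\<forall>v\<in>verts T. \<kappa> v \<in> verts A \<and> h A (\<kappa> v) = f v"
      using bchoice[of "verts T" "\<lambda>v a. a \<in> verts A \<and> h A a = f v"] by blast
    have "\<exists>ys. ys \<in> rels A R \<and> map (h A) ys = map f xs" if "R \<in> sig" "xs \<in> rels T R" for R xs
      using is_homD(2)[OF f that] by force
    then obtain l where l: "\<And>R xs. R \<in> sig \<Longrightarrow> xs \<in> rels T R \<Longrightarrow> l R xs \<in> rels A R \<and> map (h A) (l R xs) = map f xs"
      by metis
    \<comment> \<open>Preimages of vertices and of tuples are chosen independently; they need only
      agree in colour, and injectivity of \<open>c\<close> turns equal colours into equal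
      types.\<close>
    have "partial_lift sig ar Ob A T \<kappa> l"
      unfolding partial_lift_def
    proof (intro conjI ballI sT)
      show "in_fam sig T Ob" unfolding in_fam_def is_iso_def
        using T by (intro bexI[of _ T] exI[of _ id]) auto
      show "\<kappa> v \<in> verts A" if "v \<in> verts T" for v using \<kappa> that by blast
      fix R xs assume R: "R \<in> sig" "xs \<in> rels T R"
      show "l R xs \<in> rels A R" using l[OF R] by blast
      have eq: "map (h A) (l R xs) = map (h A) (map \<kappa> xs)"
        using l[OF R] \<kappa> is_strucD(4)[OF sT R(2)] by simp
      have len: "length (l R xs) = length xs" using arg_cong[OF eq, of length] by simp
      show "map ?\<psi> (l R xs) = map ?\<psi> (map \<kappa> xs)"
      proof (rule nth_equalityI)
        fix j assume j: "j < length (map ?\<psi> (l R xs))"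
        then have "h A (l R xs ! j) = h A (\<kappa> (xs ! j))"
          using arg_cong[OF eq, of "\<lambda>zs. zs ! j"] len by simp
        from same[OF this] show "map ?\<psi> (l R xs) ! j = map ?\<psi> (map \<kappa> xs) ! j"
          using j len by simp
      qed (simp add: len)
    qed
    then show ?thesis by (rule partial_lift_imp_hom[OF sig A forests])
  qed
  have "duality_pair sig ar Ob Ds"
    unfolding duality_pair_def
  proof (intro allI impI iffI notI)
    fix A assume "is_struc sig ar A" "\<exists>D\<in>Ds. hom_to sig A D" "\<exists>T\<in>Ob. hom_to sig T A"
    then obtain T B where "T \<in> Ob" "is_struc sig ar B" "\<not> (\<exists>T\<in>Ob. hom_to sig T B)"
      "hom_to sig T (image_struc (h B) B)"
      unfolding Ds_def using hom_to_trans by blast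
    then show False using key unfolding hom_to_def by blast
  next
    fix A assume "is_struc sig ar A" "\<not> (\<exists>T\<in>Ob. hom_to sig T A)"
    then have "image_struc (h A) A \<in> Ds" unfolding Ds_def by blast
    then show "\<exists>D\<in>Ds. hom_to sig A D" using is_hom_image unfolding hom_to_def by blast
  qed
  then show ?thesis using that finDs strDs by blast
qed

theorem theorem5p3:
  fixes sig :: "'r set" and ar :: "'r \<Rightarrow> nat" and Ob :: "'r struc set"
  assumes "finite sig"
    and "\<forall>T\<in>Ob. is_core sig ar T"
    and "antichain sig Ob"
  shows "(\<exists>D. finite D \<and> (\<forall>D0\<in>D. is_struc sig ar D0) \<and> duality_pair sig ar Ob D) \<longleftrightarrow>
         ((\<forall>T\<in>Ob. is_forest sig ar T) \<and> regular sig ar Ob)"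
proof
  assume "\<exists>D. finite D \<and> (\<forall>D0\<in>D. is_struc sig ar D0) \<and> duality_pair sig ar Ob D"
  then obtain D where D: "finite D" "\<forall>D0\<in>D. is_struc sig ar D0" "duality_pair sig ar Ob D" by blast
  show "(\<forall>T\<in>Ob. is_forest sig ar T) \<and> regular sig ar Ob"
    using duality_imp_forest[OF D(3) assms(2,3) D(1,2)]
      duality_imp_regular[OF D(3) assms(2,3,1) D(1,2)] by blast
next
  assume "(\<forall>T\<in>Ob. is_forest sig ar T) \<and> regular sig ar Ob"
  then show "\<exists>D. finite D \<and> (\<forall>D0\<in>D. is_struc sig ar D0) \<and> duality_pair sig ar Ob D"
    using regular_imp_duality[OF assms(1)] by metis
qed

end
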